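(* Let $0<s<1$. The quadratic form $$\mathcal{D}(u,\phi)=\mathcal{D}_s(u,\phi)=\int_{\mathbb G}\int_{\mathbb G}\frac{(u(g)-u(h))(\phi(g)-\phi(h))}{|h^{-1}g|^{Q+2s}}\,dg\,dh$$ is a (well-defined, finite) symmetric form on $C_0^\infty(\mathbb G)$. In fact, for all $u,\phi\in C_0^\infty(\mathbb G)$, $$\mathcal{D}(u,\phi)=\int_{\mathbb G}\phi(g)\,\mathcal{L}_s u(g)\,dg,$$ where $$\mathcal{L}_s u(g)=\int_{\mathbb G}\frac{2u(g)-u(gh)-u(gh^{-1})}{|h|^{Q+2s}}\,dh .$$ Furthermore, for every $u\in C_0^\infty(\mathbb G)$ and $g\in\mathbb G$, $$\mathcal{L}_s u(g)=2\lim_{\varepsilon\to 0}\int_{\mathbb G\setminus B(g,\varepsilon)}\frac{u(g)-u(h)}{|h^{-1}g|^{Q+2s}}\,dh .$$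
   Context: $\mathbb G$ is a homogeneous group: a connected, simply connected nilpotent Lie group whose Lie algebra $\mathfrak g$ carries a family of automorphisms (dilations) $\{\Delta_\lambda\}_{\lambda>0}$ for which there are a basis $X_1,\dots,X_n$ of $\mathfrak g$ and reals $1=d_1\le d_2\le\dots\le d_n$ with $\Delta_\lambda X_j=\lambda^{d_j}X_j$. The group is not assumed to be Carnot (stratified). Group dilations are $\delta_\lambda=\exp\circ\Delta_\lambda\circ\exp^{-1}$, and $Q=d_1+\dots+d_n$ is the homogeneous dimension. $dg$ (or $dh$) is a fixed bi-invariant Haar measure (the push-forward of Lebesgue measure on $\mathfrak g$ under $\exp$), so $d(\delta_\lambda g)=\lambda^Q dg$. $|\cdot|$ is a fixed homogeneous norm: $|\cdot|\in C(\mathbb G)\cap C^\infty(\mathbb G\setminus\{e\})$ ($e$ the identity), $|g|\ge 0$ with $|g|=0$ iff $g=e$, $|g^{-1}|=|g|$, $|\delta_\lambda g|=\lambda|g|$, and $|gh|\le|g|+|h|$. $B(g,R)=B_R(g)=\{h:|g^{-1}h|<R\}$. $C_0^\infty(\mathbb G)$ denotes the (real-valued) smooth functions with compact support. *)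

theory Defs
  imports "HOL-Analysis.Analysis"
begin

text \<open>
  Groups are written additively, following the library class \<^class>\<open>topological_group_add\<close>,
  which does not assume commutativity: \<open>g + h\<close>, \<open>- g\<close>, \<open>g - h = g + (- h)\<close> and \<open>0\<close> stand for
  \<open>gh\<close>, the inverse of \<open>g\<close>, \<open>g\<close> times the inverse of \<open>h\<close>, and the identity \<open>e\<close>.

  The exponential map of a connected, simply connected nilpotent Lie group is a global
  diffeomorphism from its Lie algebra, so that it is a global chart. A Lie group is presented
  here through this chart: \<open>E :: 'a \<Rightarrow> 'g\<close> is the exponential map from the Lie algebra \<open>'a\<close> to the
  group \<open>'g\<close>, its inverse is \<open>inv E\<close>, and smoothness on the group is smoothness in this chart.
\<close>

subsection \<open>Smooth functions\<close>

text \<open>Meant for open \<open>S\<close>.\<close>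

primrec higher_differentiable_on ::
  "'a::real_normed_vector set \<Rightarrow> ('a \<Rightarrow> 'b::real_normed_vector) \<Rightarrow> nat \<Rightarrow> bool" where
  "higher_differentiable_on S f 0 \<longleftrightarrow> continuous_on S f"
| "higher_differentiable_on S f (Suc k) \<longleftrightarrow>
    (\<forall>x\<in>S. f differentiable (at x)) \<and>
    (\<forall>v. higher_differentiable_on S (\<lambda>x. frechet_derivative f (at x) v) k)"

definition smooth_on :: "'a::real_normed_vector set \<Rightarrow> ('a \<Rightarrow> 'b::real_normed_vector) \<Rightarrow> bool" where
  "smooth_on S f \<longleftrightarrow> (\<forall>k. higher_differentiable_on S f k)"

subsection \<open>Lie groups in the exponential chart\<close>

text \<open>
  The last condition says that \<open>t \<mapsto> E (t *\<^sub>R X)\<close> is a one-parameter subgroup. Its velocity at \<open>0\<close>,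
  read in the chart \<open>E\<close>, is \<open>X\<close>, so \<open>E\<close> is the Lie group exponential once the tangent space at the
  identity is identified with \<open>'a\<close> through the chart.
\<close>

definition lie_group_exp :: "('a::euclidean_space \<Rightarrow> 'g::topological_group_add) \<Rightarrow> bool" where
  "lie_group_exp E \<longleftrightarrow>
    homeomorphism UNIV UNIV E (inv E) \<and>
    smooth_on UNIV (\<lambda>p. inv E (E (fst p) + E (snd p))) \<and>
    smooth_on UNIV (\<lambda>X. inv E (- E X)) \<and>
    (\<forall>X s t. E ((s + t) *\<^sub>R X) = E (s *\<^sub>R X) + E (t *\<^sub>R X))"

text \<open>The left-invariant vector field with value \<open>X\<close> at the identity, in the chart \<open>E\<close>.\<close>

definition left_invariant_field ::
  "('a::euclidean_space \<Rightarrow> 'g::topological_group_add) \<Rightarrow> 'a \<Rightarrow> 'a \<Rightarrow> 'a" where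
  "left_invariant_field E X p = vector_derivative (\<lambda>t. inv E (E p + E (t *\<^sub>R X))) (at 0)"

text \<open>The commutator of the left-invariant vector fields of \<open>X\<close> and \<open>Y\<close>, at the identity (which the
  chart sends to \<open>0\<close>; the two fields take the values \<open>X\<close> and \<open>Y\<close> there).\<close>

definition lie_bracket ::
  "('a::euclidean_space \<Rightarrow> 'g::topological_group_add) \<Rightarrow> 'a \<Rightarrow> 'a \<Rightarrow> 'a" where
  "lie_bracket E X Y =
    frechet_derivative (left_invariant_field E Y) (at 0) X -
    frechet_derivative (left_invariant_field E X) (at 0) Y"

primrec lower_central_series ::
  "('a::euclidean_space \<Rightarrow> 'g::topological_group_add) \<Rightarrow> nat \<Rightarrow> 'a set" where
  "lower_central_series E 0 = UNIV"
| "lower_central_series E (Suc k) = span {lie_bracket E X Y |X Y. Y \<in> lower_central_series E k}"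

definition nilpotent_lie :: "('a::euclidean_space \<Rightarrow> 'g::topological_group_add) \<Rightarrow> bool" where
  "nilpotent_lie E \<longleftrightarrow> (\<exists>k. lower_central_series E k = {0})"

definition lie_automorphism ::
  "('a::euclidean_space \<Rightarrow> 'g::topological_group_add) \<Rightarrow> ('a \<Rightarrow> 'a) \<Rightarrow> bool" where
  "lie_automorphism E A \<longleftrightarrow> linear A \<and> bij A \<and>
    (\<forall>X Y. A (lie_bracket E X Y) = lie_bracket E (A X) (A Y))"

subsection \<open>Homogeneous groups\<close>

definition homogeneous_group ::
  "('a::euclidean_space \<Rightarrow> 'g::topological_group_add) \<Rightarrow> (real \<Rightarrow> 'a \<Rightarrow> 'a) \<Rightarrow>
    nat \<Rightarrow> (nat \<Rightarrow> 'a) \<Rightarrow> (nat \<Rightarrow> real) \<Rightarrow> bool" where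
  "homogeneous_group E \<Delta> n X d \<longleftrightarrow>
    lie_group_exp E \<and> nilpotent_lie E \<and>
    (\<forall>l>0. lie_automorphism E (\<Delta> l)) \<and>
    inj_on X {1..n} \<and> independent (X ` {1..n}) \<and> span (X ` {1..n}) = UNIV \<and>
    d 1 = 1 \<and> (\<forall>i j. 1 \<le> i \<and> i \<le> j \<and> j \<le> n \<longrightarrow> d i \<le> d j) \<and>
    (\<forall>l>0. \<forall>j\<in>{1..n}. \<Delta> l (X j) = (l powr d j) *\<^sub>R X j)"

definition group_dilation ::
  "('a::euclidean_space \<Rightarrow> 'g::topological_group_add) \<Rightarrow> (real \<Rightarrow> 'a \<Rightarrow> 'a) \<Rightarrow> real \<Rightarrow> 'g \<Rightarrow> 'g" where
  "group_dilation E \<Delta> l = E \<circ> \<Delta> l \<circ> inv E"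

text \<open>Push-forward of Lebesgue measure; it is a bi-invariant Haar measure on a nilpotent group.\<close>

definition haar :: "('a::euclidean_space \<Rightarrow> 'g::topological_group_add) \<Rightarrow> 'g measure" where
  "haar E = distr lborel borel E"

text \<open>The chart sends the identity to \<open>0\<close>, so smoothness of \<open>N\<close> away from the identity is
  smoothness of \<open>N \<circ> E\<close> on \<open>- {0}\<close>.\<close>

definition homogeneous_norm ::
  "('a::euclidean_space \<Rightarrow> 'g::topological_group_add) \<Rightarrow> (real \<Rightarrow> 'a \<Rightarrow> 'a) \<Rightarrow> ('g \<Rightarrow> real) \<Rightarrow> bool" where
  "homogeneous_norm E \<Delta> N \<longleftrightarrow>
    continuous_on UNIV N \<and> smooth_on (- {0}) (N \<circ> E) \<and>
    (\<forall>g. 0 \<le> N g) \<and> (\<forall>g. N g = 0 \<longleftrightarrow> g = 0) \<and>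
    (\<forall>g. N (- g) = N g) \<and>
    (\<forall>l>0. \<forall>g. N (group_dilation E \<Delta> l g) = l * N g) \<and>
    (\<forall>g h. N (g + h) \<le> N g + N h)"

definition norm_ball :: "('g::topological_group_add \<Rightarrow> real) \<Rightarrow> 'g \<Rightarrow> real \<Rightarrow> 'g set" where
  "norm_ball N g R = {h. N (- g + h) < R}"

definition test_functions ::
  "('a::euclidean_space \<Rightarrow> 'g::topological_group_add) \<Rightarrow> ('g \<Rightarrow> real) set" where
  "test_functions E = {u. smooth_on UNIV (u \<circ> E) \<and> compact (closure {g. u g \<noteq> 0})}"

subsection \<open>The fractional form and operator\<close>

text \<open>In the following, \<open>Q\<close> is the homogeneous dimension. The library integral of a
  non-integrable function is \<open>0\<close>, so integrability has to be claimed separately. The values of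
  the kernels where the denominator vanishes (\<open>x / 0 = 0\<close>) only matter on null sets.\<close>

definition dirichlet_integrand ::
  "('g::topological_group_add \<Rightarrow> real) \<Rightarrow> real \<Rightarrow> real \<Rightarrow>
    ('g \<Rightarrow> real) \<Rightarrow> ('g \<Rightarrow> real) \<Rightarrow> 'g \<Rightarrow> 'g \<Rightarrow> real" where
  "dirichlet_integrand N Q s u \<phi> g h =
    (u g - u h) * (\<phi> g - \<phi> h) / N (- h + g) powr (Q + 2 * s)"

definition dirichlet_form ::
  "('a::euclidean_space \<Rightarrow> 'g::topological_group_add) \<Rightarrow> ('g \<Rightarrow> real) \<Rightarrow> real \<Rightarrow> real \<Rightarrow>
    ('g \<Rightarrow> real) \<Rightarrow> ('g \<Rightarrow> real) \<Rightarrow> real" where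
  "dirichlet_form E N Q s u \<phi> =
    (\<integral>h. (\<integral>g. dirichlet_integrand N Q s u \<phi> g h \<partial>haar E) \<partial>haar E)"

definition frac_integrand ::
  "('g::topological_group_add \<Rightarrow> real) \<Rightarrow> real \<Rightarrow> real \<Rightarrow> ('g \<Rightarrow> real) \<Rightarrow> 'g \<Rightarrow> 'g \<Rightarrow> real" where
  "frac_integrand N Q s u g h =
    (2 * u g - u (g + h) - u (g - h)) / N h powr (Q + 2 * s)"

definition frac_operator ::
  "('a::euclidean_space \<Rightarrow> 'g::topological_group_add) \<Rightarrow> ('g \<Rightarrow> real) \<Rightarrow> real \<Rightarrow> real \<Rightarrow>
    ('g \<Rightarrow> real) \<Rightarrow> 'g \<Rightarrow> real" where
  "frac_operator E N Q s u g = (\<integral>h. frac_integrand N Q s u g h \<partial>haar E)"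

end

theory Submission
  imports Defs
begin

text \<open>
  Lebesgue measure in the exponential chart is left invariant because the differentials of left
  translations have determinant one. Their determinants are quotients of values of the
  determinant of the Maurer-Cartan form \<open>\<Omega>\<^sub>p\<close>. Along a ray, \<open>\<psi>(t) = t \<Omega>\<^bsub>tp\<^esub>\<close> solves
  \<open>\<psi>' = id - ad p \<circ> \<psi>\<close>, \<open>\<psi>(0) = 0\<close>; as \<open>ad p\<close> is nilpotent, the solution is unique, so
  every Lie algebra automorphism, in particular every dilation, intertwines \<open>\<Omega>\<close>. Hence
  \<open>det \<Omega>\<close> is constant on dilation orbits, and letting \<open>\<lambda> \<rightarrow> 0\<close> the constant is \<open>det \<Omega>\<^sub>0 = 1\<close>.
  Inversion is \<open>p \<mapsto> - p\<close> in the chart, which gives right invariance.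

  Since all \<open>d\<^sub>j \<ge> 1\<close>, the Euclidean norm is \<open>O(N)\<close> near the identity, so first and second
  differences of a test function are \<open>O(min 1 N)\<close> and \<open>O((min 1 N)\<^sup>2)\<close>, and \<open>(min 1 N)\<^sup>2\<close> is integrable
  against the kernel by scaling. Substituting \<open>g = h k\<close> in the form, the inner integral over \<open>h\<close> for
  fixed \<open>k\<close> becomes \<open>\<integral> \<phi>(h) (2 u(h) - u(h k) - u(h k\<^sup>-\<^sup>1)) dh\<close> by right invariance, and Fubini gives
  the operator. The truncated integrals are symmetrized by \<open>k \<mapsto> k\<^sup>-\<^sup>1\<close> and converge by domination.
\<close>

subsection \<open>Determinants and volume on Euclidean spaces\<close>

text \<open>The library has determinants and the change of variables formula only on \<^typ>\<open>real ^ 'n\<close>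
  with a well-ordered index type. The type \<open>'a coord\<close> indexes the standard basis of \<open>'a\<close>.\<close>

typedef (overloaded) 'a::euclidean_space coord = "Basis :: 'a set"
  by (rule ex_in_conv[THEN iffD2, OF nonempty_Basis])

lemma range_Rep_coord: "range (Rep_coord :: 'a::euclidean_space coord \<Rightarrow> 'a) = Basis"
  using type_definition.Rep_range[OF type_definition_coord] .

lemma Rep_coord_Basis [simp]: "Rep_coord i \<in> Basis"
  using Rep_coord[of i] .

lemma bij_betw_Rep_coord: "bij_betw Rep_coord UNIV (Basis :: 'a::euclidean_space set)"
  unfolding bij_betw_def using range_Rep_coord by (simp add: inj_on_def Rep_coord_inject)

instantiation coord :: (euclidean_space) wellorder
begin

text \<open>The order carries no meaning of its own: it is pulled back along an enumeration of the
  finite basis, which makes it well-founded at once.\<close>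

definition less_eq_coord :: "'a coord \<Rightarrow> 'a coord \<Rightarrow> bool" where
  "less_eq_coord i j \<longleftrightarrow> to_nat_on Basis (Rep_coord i) \<le> to_nat_on Basis (Rep_coord j)"

definition less_coord :: "'a coord \<Rightarrow> 'a coord \<Rightarrow> bool" where
  "less_coord i j \<longleftrightarrow> to_nat_on Basis (Rep_coord i) < to_nat_on Basis (Rep_coord j)"

instance
proof
  fix P :: "'a coord \<Rightarrow> bool" and a
  assume *: "\<And>x. (\<And>y. y < x \<Longrightarrow> P y) \<Longrightarrow> P x"
  show "P a"
  proof (induction "to_nat_on Basis (Rep_coord a)" arbitrary: a rule: less_induct)
    case less
    show ?case by (rule *) (simp add: less less_coord_def)
  qed
next
  fix x y :: "'a coord"
  have c: "countable (Basis :: 'a set)" by (simp add: countable_finite)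
  show "x = y" if "x \<le> y" "y \<le> x"
    using that inj_on_to_nat_on[OF c]
    by (metis Rep_coord_Basis Rep_coord_inject antisym inj_on_def less_eq_coord_def)
qed (auto simp: less_eq_coord_def less_coord_def)

end

instance coord :: (euclidean_space) finite
proof
  show "finite (UNIV :: 'a coord set)"
    using bij_betw_finite[OF bij_betw_Rep_coord] by simp
qed

section \<open>Coordinates that preserve Lebesgue measure\<close>

definition of_coords :: "real ^ 'a coord \<Rightarrow> 'a::euclidean_space" where
  "of_coords x = (\<Sum>i\<in>UNIV. (x $ i) *\<^sub>R Rep_coord i)"

definition to_coords :: "'a::euclidean_space \<Rightarrow> real ^ 'a coord" where
  "to_coords p = (\<chi> i. p \<bullet> Rep_coord i)"

lemma sum_Rep_coord: "(\<Sum>i\<in>UNIV. f (Rep_coord i)) = (\<Sum>b\<in>(Basis::'a::euclidean_space set). f b)"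
  by (rule sum.reindex_bij_betw[OF bij_betw_Rep_coord])

lemma prod_Rep_coord: "(\<Prod>i\<in>UNIV. f (Rep_coord i)) = (\<Prod>b\<in>(Basis::'a::euclidean_space set). f b)"
  by (rule prod.reindex_bij_betw[OF bij_betw_Rep_coord])

lemma of_to_coords [simp]: "of_coords (to_coords p) = p"
  unfolding of_coords_def to_coords_def
  by (simp add: sum_Rep_coord[of "\<lambda>b. (p \<bullet> b) *\<^sub>R b"] euclidean_representation)

lemma to_of_coords [simp]: "to_coords (of_coords x) = x"
proof -
  have "(\<Sum>j\<in>UNIV. x $ j * (Rep_coord j \<bullet> Rep_coord i)) = x $ i" for i
  proof -
    have "(\<Sum>j\<in>UNIV. x $ j * (Rep_coord j \<bullet> Rep_coord i)) = (\<Sum>j\<in>UNIV. if j = i then x $ j else 0)"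
      by (intro sum.cong refl) (auto simp: inner_Basis Rep_coord_inject)
    then show ?thesis by simp
  qed
  then show ?thesis
    by (simp add: of_coords_def to_coords_def inner_sum_left vec_eq_iff)
qed

lemma linear_of_coords: "linear of_coords"
  unfolding of_coords_def
  by (auto intro!: linearI simp: sum.distrib scaleR_sum_right algebra_simps)

lemma linear_to_coords: "linear to_coords"
  unfolding to_coords_def by (auto intro!: linearI simp: vec_eq_iff inner_add_left)

lemma bij_of_coords: "bij of_coords"
  by (rule o_bij[of to_coords]) auto

lemma bij_to_coords: "bij to_coords"
  by (rule o_bij[of of_coords]) auto

lemma measurable_of_coords [measurable]: "of_coords \<in> borel_measurable borel"
  by (rule borel_measurable_continuous_onI[OF linear_continuous_on])
    (simp add: linear_of_coords linear_conv_bounded_linear[symmetric])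

lemma measurable_to_coords [measurable]: "to_coords \<in> borel_measurable borel"
  by (rule borel_measurable_continuous_onI[OF linear_continuous_on])
    (simp add: linear_to_coords linear_conv_bounded_linear[symmetric])

lemma vimage_of_coords: "of_coords -` S = to_coords ` S"
  by (force simp: image_iff)

text \<open>Lebesgue measure is determined by its values on boxes, and the preimage of a box under
  \<open>of_coords\<close> is a box with the same side lengths.\<close>

lemma distr_of_coords: "distr lborel borel of_coords = (lborel :: 'a::euclidean_space measure)"
proof (rule lborel_eqI[symmetric])
  fix l u :: 'a
  assume le: "\<And>b. b \<in> Basis \<Longrightarrow> l \<bullet> b \<le> u \<bullet> b"
  have vim: "of_coords -` box l u = box (to_coords l) (to_coords u)"
  proof (intro set_eqI)
    fix x :: "real ^ 'a coord"
    have "x \<in> of_coords -` box l u \<longleftrightarrow> (\<forall>b\<in>Basis. l \<bullet> b < of_coords x \<bullet> b \<and> of_coords x \<bullet> b < u \<bullet> b)"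
      by (simp add: mem_box)
    also have "\<dots> \<longleftrightarrow> (\<forall>i. to_coords l $ i < x $ i \<and> x $ i < to_coords u $ i)"
    proof -
      have "x $ i = of_coords x \<bullet> Rep_coord i" for i
        using arg_cong[OF to_of_coords[of x], of "\<lambda>y. y $ i"] by (simp add: to_coords_def)
      moreover have "(\<forall>b\<in>(Basis::'a set). P b) \<longleftrightarrow> (\<forall>i. P (Rep_coord i))" for P
        by (metis Rep_coord_Basis Rep_coord_cases)
      ultimately show ?thesis by (simp add: to_coords_def)
    qed
    finally show "x \<in> of_coords -` box l u \<longleftrightarrow> x \<in> box (to_coords l) (to_coords u)"
      by (simp add: mem_box_cart)
  qed
  have "emeasure (distr lborel borel of_coords) (box l u) = emeasure lborel (box (to_coords l) (to_coords u))"
    by (subst emeasure_distr) (auto simp: vim)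
  also have "\<dots> = ennreal (\<Prod>b\<in>Basis. (to_coords u - to_coords l) \<bullet> b)"
    by (rule emeasure_lborel_box)
       (use le in \<open>auto simp: Basis_vec_def inner_axis to_coords_def\<close>)
  also have "(\<Prod>b\<in>Basis. (to_coords u - to_coords l) \<bullet> b) = (\<Prod>i\<in>UNIV. (to_coords u - to_coords l) $ i)"
  proof -
    have inj: "inj (\<lambda>i::'a coord. axis i (1::real))"
      by (auto intro!: injI simp: axis_eq_axis)
    have B: "(Basis :: (real ^ 'a coord) set) = range (\<lambda>i. axis i 1)"
      by (auto simp: Basis_vec_def)
    show ?thesis
      unfolding B by (subst prod.reindex[OF inj]) (simp add: inner_axis)
  qed
  also have "\<dots> = (\<Prod>b\<in>Basis. (u - l) \<bullet> b)"
    using prod_Rep_coord[of "\<lambda>b. (u - l) \<bullet> b"] by (simp add: to_coords_def inner_diff_left)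
  finally show "emeasure (distr lborel borel of_coords) (box l u) = (\<Prod>b\<in>Basis. (u - l) \<bullet> b)"
    by simp
qed simp

lemma emeasure_lborel_to_coords:
  assumes "S \<in> sets borel"
  shows "emeasure lborel (to_coords ` S) = emeasure lborel (S :: 'a::euclidean_space set)"
proof -
  have "emeasure lborel S = emeasure (distr lborel borel of_coords) S"
    by (simp add: distr_of_coords)
  also have "\<dots> = emeasure lborel (of_coords -` S \<inter> space lborel)"
    using assms by (intro emeasure_distr) auto
  finally show ?thesis by (simp add: vimage_of_coords)
qed

lemma to_coords_borel: "S \<in> sets borel \<Longrightarrow> to_coords ` S \<in> sets borel"
  using measurable_sets[OF measurable_of_coords, of S] by (simp add: vimage_of_coords)

section \<open>Determinants of endomorphisms and maps of constant Jacobian\<close>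

definition edet :: "('a::euclidean_space \<Rightarrow> 'a) \<Rightarrow> real" where
  "edet A = det (matrix (to_coords \<circ> A \<circ> of_coords))"

lemma edet_compose:
  assumes "linear A" "linear B"
  shows "edet (A \<circ> B) = edet A * edet B"
proof -
  have 1: "linear (to_coords \<circ> A \<circ> of_coords)" "linear (to_coords \<circ> B \<circ> of_coords)"
    using assms linear_of_coords linear_to_coords by (auto intro!: linear_compose)
  have "(to_coords \<circ> A \<circ> of_coords) \<circ> (to_coords \<circ> B \<circ> of_coords) = to_coords \<circ> (A \<circ> B) \<circ> of_coords"
    by (auto simp: fun_eq_iff)
  then show ?thesis
    unfolding edet_def using matrix_compose[OF 1(2,1)] by (simp add: det_mul)
qed

lemma edet_id: "edet id = 1" "edet (\<lambda>x. x) = 1"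
proof -
  have *: "to_coords \<circ> of_coords = id" "to_coords \<circ> (\<lambda>x. x) \<circ> of_coords = id" by auto
  show "edet id = 1" "edet (\<lambda>x. x) = 1" unfolding edet_def o_id * by simp_all
qed

text \<open>A determinant is a polynomial in the matrix entries, and each entry is a coordinate of
  the image of a basis vector, so pointwise convergence is enough.\<close>

lemma tendsto_edet:
  assumes "\<And>v. ((\<lambda>x. A x v) \<longlongrightarrow> B v) F"
  shows "((\<lambda>x. edet (A x)) \<longlongrightarrow> edet B) F"
proof -
  have "((\<lambda>x. matrix (to_coords \<circ> A x \<circ> of_coords) $ i $ j) \<longlongrightarrow>
      matrix (to_coords \<circ> B \<circ> of_coords) $ i $ j) F" for i j
    unfolding matrix_def to_coords_def using assms by (auto intro!: tendsto_intros)
  then show ?thesis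
    unfolding edet_def det_def by (intro tendsto_sum tendsto_mult tendsto_const tendsto_prod)
qed

text \<open>The coordinates preserve volume, so the change of variables formula carries over, and a
  constant Jacobian comes out of the integral. This covers left translations (\<open>c = 1\<close>)
  as well as dilations (\<open>c = r powr Q\<close>). Finite measure of \<open>S\<close> allows the
  passage between real and extended values.\<close>

lemma emeasure_image_edet:
  fixes f :: "'a::euclidean_space \<Rightarrow> 'a"
  assumes der: "\<And>x. (f has_derivative f' x) (at x)" and inj: "inj f"
    and c: "\<And>x. \<bar>edet (f' x)\<bar> = c"
    and S: "S \<in> sets borel" "emeasure lborel S < \<infinity>" and fS: "f ` S \<in> sets borel"
  shows "emeasure lborel (f ` S) = ennreal c * emeasure lborel S"
proof -
  let ?f = "to_coords \<circ> f \<circ> of_coords" and ?f' = "\<lambda>x. to_coords \<circ> f' (of_coords x) \<circ> of_coords"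
  let ?S = "to_coords ` S"
  have S': "?S \<in> sets borel" and eS: "emeasure lborel ?S = emeasure lborel S"
    using S to_coords_borel emeasure_lborel_to_coords by auto
  have im: "?f ` ?S = to_coords ` (f ` S)" by (auto simp: image_comp)
  have fm: "?S \<in> lmeasurable"
    using S' eS S(2) by (intro fmeasurableI) (auto simp: emeasure_completion less_top)
  have meas: "measure lebesgue ?S = measure lborel S"
    using S' eS by (simp add: measure_def)
  have bl: "bounded_linear (to_coords::'a \<Rightarrow> _)" "bounded_linear (of_coords::_ \<Rightarrow> 'a)"
    using linear_of_coords linear_to_coords by (auto simp: linear_linear)
  have der': "(?f has_derivative ?f' x) (at x within ?S)" for x
    unfolding comp_def
    by (rule has_derivative_at_withinI)
       (intro bounded_linear.has_derivative[OF bl(1)]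
         has_derivative_compose[OF bounded_linear.has_derivative[OF bl(2) has_derivative_ident] der])
  have inj': "inj_on ?f ?S"
    using inj bij_of_coords[THEN bij_is_inj] bij_to_coords[THEN bij_is_inj]
    by (intro inj_on_subset[OF inj_compose[OF inj_compose]]) auto
  have "((\<lambda>x. \<bar>det (matrix (?f' x))\<bar>) has_integral (c * measure lborel S)) ?S"
  proof -
    have *: "\<bar>det (matrix (?f' x))\<bar> = c" for x
      using c[of "of_coords x"] by (simp add: edet_def)
    have "?S \<in> lmeasurable \<Longrightarrow> ((\<lambda>x. c * 1) has_integral (c * measure lebesgue ?S)) ?S"
      by (intro has_integral_mult_right)
         (simp add: has_integral_iff lmeasure_integral flip: lmeasurable_iff_integrable_on)
    then show ?thesis using fm * meas by simp
  qed
  then have "?f ` ?S \<in> lmeasurable \<and> measure lebesgue (?f ` ?S) = c * measure lborel S"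
    using has_measure_differentiable_image[OF _ der' inj'] S' by (simp add: sets_completionI_sets)
  moreover have "emeasure lebesgue (?f ` ?S) = emeasure lborel (f ` S)"
    unfolding im using to_coords_borel[OF fS] emeasure_lborel_to_coords[OF fS]
    by (subst emeasure_completion) auto
  moreover have "c \<ge> 0" using c[of 0] by auto
  moreover have "emeasure lebesgue (?f ` ?S) = ennreal (measure lebesgue (?f ` ?S))"
    using calculation(1) by (simp add: emeasure_eq_measure2)
  moreover have "emeasure lborel S = ennreal (measure lborel S)"
    using S(2) by (simp add: emeasure_eq_ennreal_measure)
  ultimately show ?thesis
    by (simp add: ennreal_mult)
qed

text \<open>The map \<open>T\<close> from coordinates to eigenvector expansions conjugates
  \<open>A\<close> to the diagonal map \<open>D\<close>. It is surjective, hence of nonzero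
  determinant, which cancels.\<close>

lemma edet_eigenbasis:
  fixes A :: "'a::euclidean_space \<Rightarrow> 'a"
  assumes A: "linear A" and X: "inj_on X {1..n}" "independent (X ` {1..n})" "span (X ` {1..n}) = UNIV"
    and ev: "\<And>j. j \<in> {1..n} \<Longrightarrow> A (X j) = c j *\<^sub>R X j"
  shows "edet A = (\<Prod>j = 1..n::nat. c j)"
proof -
  have "card (X ` {1..n}) = DIM('a)"
    using X(2,3) by (metis basis_card_eq_dim dim_UNIV subset_UNIV top_greatest)
  then have n: "n = DIM('a)"
    using X(1) by (simp add: card_image)
  have "card (UNIV :: 'a coord set) = DIM('a)"
    using bij_betw_same_card[OF bij_betw_Rep_coord] by blast
  \<comment> \<open>There are as many eigenvectors as coordinates, so \<open>\<sigma>\<close> can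
    relabel \<open>{1..n}\<close> by the index type of the matrices.\<close>
  then obtain \<sigma> :: "'a coord \<Rightarrow> nat" where \<sigma>: "bij_betw \<sigma> UNIV {1..n}"
    using n finite_same_card_bij[of "UNIV :: 'a coord set" "{1..n}"] by auto
  define T where "T x = (\<Sum>i\<in>UNIV. (x $ i) *\<^sub>R X (\<sigma> i))" for x :: "real ^ 'a coord"
  define D where "D x = (\<chi> i. c (\<sigma> i) * x $ i)" for x :: "real ^ 'a coord"
  have linT: "linear T" and linD: "linear D"
    unfolding T_def D_def
    by (auto intro!: linearI simp: sum.distrib scaleR_sum_right algebra_simps vec_eq_iff)
  have inT: "X (\<sigma> i) \<in> range T" for i
    by (rule range_eqI[of _ _ "axis i 1"]) (simp add: T_def axis_def if_distrib[of "\<lambda>a. a *\<^sub>R _"] cong: if_cong)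
  have "X ` {1..n} \<subseteq> range T"
    using inT unfolding bij_betw_imp_surj_on[OF \<sigma>, symmetric] image_image by blast
  then have "span (X ` {1..n}) \<subseteq> range T"
    using linT by (metis linear_subspace_image span_minimal subspace_UNIV)
  then have "surj T" using X(3) by auto
  let ?T = "to_coords \<circ> T" and ?A = "to_coords \<circ> A \<circ> of_coords"
  have lin: "linear ?T" "linear ?A"
    using linT A linear_of_coords linear_to_coords by (auto intro!: linear_compose)
  have "surj ?T" using \<open>surj T\<close> bij_to_coords[THEN bij_is_surj] by (metis comp_surj)
  then have dT: "det (matrix ?T) \<noteq> 0"
    using lin(1) by (metis det_nz_iff_inj linear_surjective_imp_injective)
  have AT: "?A \<circ> ?T = ?T \<circ> D"
  proof
    fix x
    have "A (T x) = (\<Sum>i\<in>UNIV. (x $ i) *\<^sub>R A (X (\<sigma> i)))"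
      unfolding T_def by (simp add: linear_sum[OF A] linear_scale[OF A])
    also have "\<dots> = (\<Sum>i\<in>UNIV. (x $ i) *\<^sub>R (c (\<sigma> i) *\<^sub>R X (\<sigma> i)))"
      using ev bij_betwE[OF \<sigma>] by (intro sum.cong refl) auto
    also have "\<dots> = T (D x)"
      by (simp add: T_def D_def mult.commute)
    finally show "(?A \<circ> ?T) x = (?T \<circ> D) x" by simp
  qed
  have "det (matrix ?A) * det (matrix ?T) = det (matrix ?T) * det (matrix D)"
    using matrix_compose[OF lin] matrix_compose[OF linD lin(1)] AT by (metis det_mul)
  then have "edet A = det (matrix D)"
    using dT by (simp add: edet_def)
  also have "\<dots> = (\<Prod>i\<in>UNIV. c (\<sigma> i))"
    by (subst det_diagonal) (auto simp: matrix_def D_def axis_def)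
  also have "\<dots> = (\<Prod>j = 1..n. c j)"
    by (rule prod.reindex_bij_betw[OF \<sigma>])
  finally show ?thesis .
qed

subsection \<open>Functions of class C1 and C2\<close>

text \<open>The derivative is packed as a bounded linear map, so that its continuity is meant in
  operator norm and it is itself a map into a normed space that can be differentiated again.\<close>

definition C1 :: "('a::real_normed_vector \<Rightarrow> 'b::real_normed_vector) \<Rightarrow> bool" where
  "C1 f \<longleftrightarrow> (\<exists>f'. (\<forall>x. (f has_derivative blinfun_apply (f' x)) (at x)) \<and> continuous_on UNIV f')"

definition C2 :: "('a::real_normed_vector \<Rightarrow> 'b::real_normed_vector) \<Rightarrow> bool" where
  "C2 f \<longleftrightarrow> (\<exists>f'. (\<forall>x. (f has_derivative blinfun_apply (f' x)) (at x)) \<and> C1 f')"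

lemma C1_continuous: "C1 f \<Longrightarrow> continuous_on UNIV f"
  unfolding C1_def using has_derivative_continuous continuous_at_imp_continuous_on by blast

lemma C2_imp_C1: "C2 f \<Longrightarrow> C1 f"
  unfolding C2_def using C1_continuous by (subst C1_def) blast

lemma C1_const: "C1 (\<lambda>x. c)"
  unfolding C1_def by (rule exI[of _ "\<lambda>x. 0"]) (auto intro!: derivative_eq_intros)

lemma C1_bounded_linear:
  assumes "bounded_linear B" "C1 f"
  shows "C1 (\<lambda>x. B (f x))"
proof -
  obtain f' where f': "\<And>x. (f has_derivative blinfun_apply (f' x)) (at x)" "continuous_on UNIV f'"
    using assms(2) by (auto simp: C1_def)
  show ?thesis
    unfolding C1_def
  proof (intro exI conjI allI)
    show "((\<lambda>x. B (f x)) has_derivative blinfun_apply (Blinfun B o\<^sub>L f' x)) (at x)" for x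
      using bounded_linear.has_derivative[OF assms(1) f'(1)[of x]]
      by (simp add: bounded_linear_Blinfun_apply[OF assms(1)] blinfun_compose.rep_eq o_def)
    show "continuous_on UNIV (\<lambda>x. Blinfun B o\<^sub>L f' x)"
      by (intro continuous_intros f'(2))
  qed
qed

lemma C1_add:
  assumes "C1 f" "C1 g"
  shows "C1 (\<lambda>x. f x + g x)"
proof -
  obtain f' where f': "\<And>x. (f has_derivative blinfun_apply (f' x)) (at x)" "continuous_on UNIV f'"
    using assms(1) by (auto simp: C1_def)
  obtain g' where g': "\<And>x. (g has_derivative blinfun_apply (g' x)) (at x)" "continuous_on UNIV g'"
    using assms(2) by (auto simp: C1_def)
  show ?thesis
    unfolding C1_def
    by (rule exI[of _ "\<lambda>x. f' x + g' x"])
       (auto intro!: continuous_intros has_derivative_add f' g' simp: plus_blinfun.rep_eq)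
qed

lemma C1_sum:
  assumes "\<And>i. i \<in> I \<Longrightarrow> C1 (f i)"
  shows "C1 (\<lambda>x. \<Sum>i\<in>I. f i x)"
  using assms by (induction I rule: infinite_finite_induct) (auto intro: C1_const C1_add)

lemma C1_bilinear:
  assumes "bounded_bilinear p" "C1 f" "C1 g"
  shows "C1 (\<lambda>x. p (f x) (g x))"
proof -
  interpret p: bounded_bilinear p by fact
  obtain f' where f': "\<And>x. (f has_derivative blinfun_apply (f' x)) (at x)" "continuous_on UNIV f'"
    using assms(2) by (auto simp: C1_def)
  obtain g' where g': "\<And>x. (g has_derivative blinfun_apply (g' x)) (at x)" "continuous_on UNIV g'"
    using assms(3) by (auto simp: C1_def)
  show ?thesis
    unfolding C1_def
  proof (intro exI conjI allI)
    show "((\<lambda>x. p (f x) (g x)) has_derivative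
       blinfun_apply ((p.prod_right (f x) o\<^sub>L g' x) + (p.prod_left (g x) o\<^sub>L f' x))) (at x)" for x
      using p.FDERIV[OF f'(1)[of x] g'(1)[of x]]
      by (simp add: plus_blinfun.rep_eq blinfun_compose.rep_eq o_def p.prod_right.rep_eq p.prod_left.rep_eq)
    show "continuous_on UNIV (\<lambda>x. (p.prod_right (f x) o\<^sub>L g' x) + (p.prod_left (g x) o\<^sub>L f' x))"
      using C1_continuous[OF assms(2)] C1_continuous[OF assms(3)]
      by (intro continuous_intros f'(2) g'(2)
        bounded_linear.continuous_on[OF p.bounded_linear_prod_right]
        bounded_linear.continuous_on[OF p.bounded_linear_prod_left])
  qed
qed

lemma C1_compose:
  assumes "C1 f" "C1 g"
  shows "C1 (\<lambda>x. f (g x))"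
proof -
  obtain f' where f': "\<And>x. (f has_derivative blinfun_apply (f' x)) (at x)" "continuous_on UNIV f'"
    using assms(1) by (auto simp: C1_def)
  obtain g' where g': "\<And>x. (g has_derivative blinfun_apply (g' x)) (at x)" "continuous_on UNIV g'"
    using assms(2) by (auto simp: C1_def)
  show ?thesis
    unfolding C1_def
  proof (intro exI conjI allI)
    show "((\<lambda>x. f (g x)) has_derivative blinfun_apply (f' (g x) o\<^sub>L g' x)) (at x)" for x
      using has_derivative_compose[OF g'(1) f'(1)] by (simp add: blinfun_compose.rep_eq o_def)
    show "continuous_on UNIV (\<lambda>x. f' (g x) o\<^sub>L g' x)"
      by (intro continuous_intros g'(2) continuous_on_compose2[OF f'(2) C1_continuous[OF assms(2)]]) auto
  qed
qed

lemma C2_compose: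
  assumes "C2 f" "C2 g"
  shows "C2 (\<lambda>x. f (g x))"
proof -
  obtain f' where f': "\<And>x. (f has_derivative blinfun_apply (f' x)) (at x)" "C1 f'"
    using assms(1) by (auto simp: C2_def)
  obtain g' where g': "\<And>x. (g has_derivative blinfun_apply (g' x)) (at x)" "C1 g'"
    using assms(2) by (auto simp: C2_def)
  show ?thesis
    unfolding C2_def
  proof (intro exI conjI allI)
    show "((\<lambda>x. f (g x)) has_derivative blinfun_apply (f' (g x) o\<^sub>L g' x)) (at x)" for x
      using has_derivative_compose[OF g'(1) f'(1)] by (simp add: blinfun_compose.rep_eq o_def)
    show "C1 (\<lambda>x. f' (g x) o\<^sub>L g' x)"
      by (intro C1_bilinear[OF bounded_bilinear_blinfun_compose] C1_compose[OF f'(2)] g'(2) C2_imp_C1 assms)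
  qed
qed

section \<open>From iterated directional derivatives to C1 and C2\<close>

lemma higher_differentiable_has_derivative:
  assumes "higher_differentiable_on UNIV f (Suc k)"
  shows "(f has_derivative blinfun_apply (Blinfun (frechet_derivative f (at x)))) (at x)"
proof -
  have "(f has_derivative frechet_derivative f (at x)) (at x)"
    using assms by (simp add: frechet_derivative_works)
  then show ?thesis
    by (metis bounded_linear_Blinfun_apply has_derivative_bounded_linear)
qed

text \<open>In finite dimension, continuity of every directional derivative already gives continuity
  of the derivative in operator norm.\<close>

lemma higher_differentiable_C1:
  fixes f :: "'a::euclidean_space \<Rightarrow> 'b::real_normed_vector"
  assumes "higher_differentiable_on UNIV f (Suc 0)"
  shows "C1 f"
  unfolding C1_def
proof (intro exI conjI allI)
  note d = higher_differentiable_has_derivative[OF assms]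
  show "(f has_derivative blinfun_apply (Blinfun (frechet_derivative f (at x)))) (at x)" for x
    by (rule d)
  have "blinfun_apply (Blinfun (frechet_derivative f (at x))) = frechet_derivative f (at x)" for x
    by (rule frechet_derivative_at[OF d])
  moreover have "continuous_on UNIV (\<lambda>x. frechet_derivative f (at x) v)" for v
    using assms by simp
  ultimately show "continuous_on UNIV (\<lambda>x. Blinfun (frechet_derivative f (at x)))"
    by (auto simp: continuous_on_eq_continuous_within intro!: continuous_blinfun_componentwiseI1)
qed

text \<open>The derivative is a finite sum, over the basis, of rank one maps that depend linearly on
  the partial derivatives, and these are C1.\<close>

lemma smooth_on_UNIV_C2:
  fixes f :: "'a::euclidean_space \<Rightarrow> 'b::real_normed_vector"
  assumes "smooth_on UNIV f"
  shows "C2 f"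
  unfolding C2_def
proof (intro exI conjI allI)
  have h: "higher_differentiable_on UNIV f (Suc (Suc 0))"
    using assms unfolding smooth_on_def by blast
  note d = higher_differentiable_has_derivative[OF h]
  let ?D = "\<lambda>x. Blinfun (frechet_derivative f (at x))"
  show "(f has_derivative blinfun_apply (?D x)) (at x)" for x
    by (rule d)
  have ap: "blinfun_apply (?D x) = frechet_derivative f (at x)" for x
    by (rule frechet_derivative_at[OF d])
  have "?D x = (\<Sum>b\<in>Basis. blinfun_scaleR_left (frechet_derivative f (at x) b) o\<^sub>L blinfun_inner_left b)" for x
  proof (rule blinfun_eqI)
    fix v :: 'a
    have "?D x v = ?D x (\<Sum>b\<in>Basis. (v \<bullet> b) *\<^sub>R b)"
      by (simp add: euclidean_representation)
    also have "\<dots> = (\<Sum>b\<in>Basis. (v \<bullet> b) *\<^sub>R ?D x b)"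
      by (simp only: blinfun.sum_right blinfun.scaleR_right)
    finally show "?D x v = (\<Sum>b\<in>Basis. blinfun_scaleR_left (frechet_derivative f (at x) b) o\<^sub>L blinfun_inner_left b) v"
      by (simp add: ap blinfun.sum_left)
  qed
  moreover have "C1 (\<lambda>x. \<Sum>b\<in>Basis. blinfun_scaleR_left (frechet_derivative f (at x) b) o\<^sub>L blinfun_inner_left b)"
  proof (intro C1_sum C1_bounded_linear[of "\<lambda>y. blinfun_scaleR_left y o\<^sub>L blinfun_inner_left _"])
    show "bounded_linear (\<lambda>y. blinfun_scaleR_left y o\<^sub>L blinfun_inner_left b)" for b :: 'a
      by (intro bounded_linear_intros)
    show "C1 (\<lambda>x. frechet_derivative f (at x) b)" for b
      using h by (intro higher_differentiable_C1) simp
  qed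
  ultimately show "C1 ?D" by simp
qed

section \<open>Mean value estimates and symmetry of second derivatives\<close>

lemma has_real_derivative_along_line:
  fixes f :: "'a::real_normed_vector \<Rightarrow> real"
  assumes "\<And>x. (f has_derivative blinfun_apply (f' x)) (at x)"
  shows "((\<lambda>t. f (x + t *\<^sub>R v)) has_real_derivative f' (x + t *\<^sub>R v) v) (at t)"
proof -
  have "((\<lambda>t. f (x + t *\<^sub>R v)) has_derivative (\<lambda>h. f' (x + t *\<^sub>R v) (h *\<^sub>R v))) (at t)"
    by (rule has_derivative_compose[OF _ assms]) (auto intro!: derivative_eq_intros)
  then show ?thesis
    by (simp add: has_field_derivative_def blinfun.scaleR_right mult.commute[of _ "blinfun_apply _ _"])
qed

text \<open>The mean value theorem is used twice: along \<open>v\<close> for the difference of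
  \<open>f\<close> in direction \<open>w\<close>, then along \<open>w\<close> for \<open>f'\<close>
  applied to \<open>v\<close>. The left side of the resulting identity is symmetric in
  \<open>v\<close> and \<open>w\<close>, which the next lemma exploits.\<close>

lemma second_difference_mean_value:
  fixes f :: "'a::real_normed_vector \<Rightarrow> real"
  assumes f': "\<And>x. (f has_derivative blinfun_apply (f' x)) (at x)"
    and f'': "\<And>x. (f' has_derivative blinfun_apply (f'' x)) (at x)" and h: "h > 0"
  obtains y where "norm (y - x) \<le> h * (norm v + norm w)"
    "f (x + h *\<^sub>R v + h *\<^sub>R w) - f (x + h *\<^sub>R v) - f (x + h *\<^sub>R w) + f x = h * h * f'' y w v"
proof -
  have d1: "((\<lambda>s. f (x + h *\<^sub>R w + s *\<^sub>R v) - f (x + s *\<^sub>R v)) has_real_derivative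
      f' (x + h *\<^sub>R w + s *\<^sub>R v) v - f' (x + s *\<^sub>R v) v) (at s)" for s
    by (intro DERIV_diff has_real_derivative_along_line f')
  obtain s where s: "0 < s" "s < h" and
    1: "(f (x + h *\<^sub>R w + h *\<^sub>R v) - f (x + h *\<^sub>R v)) - (f (x + h *\<^sub>R w + 0 *\<^sub>R v) - f (x + 0 *\<^sub>R v)) =
        (h - 0) * (f' (x + h *\<^sub>R w + s *\<^sub>R v) v - f' (x + s *\<^sub>R v) v)"
    using MVT2[OF h d1] by blast
  have f''v: "((\<lambda>x. f' x v) has_derivative blinfun_apply (Blinfun (\<lambda>w. f'' x w v))) (at x)" for x
  proof -
    have b: "bounded_linear (\<lambda>w. f'' x w v)"
      by (intro bounded_linear_intros)
    have "((\<lambda>x. f' x v) has_derivative (\<lambda>w. f'' x w v)) (at x)"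
      by (rule bounded_linear.has_derivative[OF blinfun.bounded_linear_left f''])
    then show ?thesis
      by (simp add: bounded_linear_Blinfun_apply[OF b])
  qed
  have ap: "blinfun_apply (Blinfun (\<lambda>w. f'' x w v)) w = f'' x w v" for x
    by (subst bounded_linear_Blinfun_apply) (auto intro!: bounded_linear_intros)
  obtain t where t: "0 < t" "t < h" and
    2: "f' (x + s *\<^sub>R v + h *\<^sub>R w) v - f' (x + s *\<^sub>R v + 0 *\<^sub>R w) v = (h - 0) * f'' (x + s *\<^sub>R v + t *\<^sub>R w) w v"
    using MVT2[OF h has_real_derivative_along_line[OF f''v, of "x + s *\<^sub>R v" w]] unfolding ap by blast
  show thesis
  proof (rule that)
    have "norm (s *\<^sub>R v + t *\<^sub>R w) \<le> s * norm v + t * norm w"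
      using s t by (intro norm_triangle_le) auto
    also have "\<dots> \<le> h * norm v + h * norm w"
      using s t by (intro add_mono mult_right_mono) auto
    finally show "norm (x + s *\<^sub>R v + t *\<^sub>R w - x) \<le> h * (norm v + norm w)"
      by (simp add: algebra_simps)
    have c: "x + h *\<^sub>R w + s *\<^sub>R v = x + s *\<^sub>R v + h *\<^sub>R w" "x + h *\<^sub>R w + h *\<^sub>R v = x + h *\<^sub>R v + h *\<^sub>R w"
      by (simp_all add: algebra_simps)
    show "f (x + h *\<^sub>R v + h *\<^sub>R w) - f (x + h *\<^sub>R v) - f (x + h *\<^sub>R w) + f x =
        h * h * f'' (x + s *\<^sub>R v + t *\<^sub>R w) w v"
      using 1 2 by (simp add: c)
  qed
qed

text \<open>Computing the same second difference in both orders gives equal values of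
  \<open>f''\<close> at two points close to \<open>x\<close>; by continuity the values at
  \<open>x\<close> cannot differ.\<close>

lemma symmetric_second_derivative_real:
  fixes f :: "'a::real_normed_vector \<Rightarrow> real"
  assumes f': "\<And>x. (f has_derivative blinfun_apply (f' x)) (at x)"
    and f'': "\<And>x. (f' has_derivative blinfun_apply (f'' x)) (at x)"
    and cont: "continuous_on UNIV f''"
  shows "f'' x v w = f'' x w v"
proof (rule ccontr)
  assume ne: "f'' x v w \<noteq> f'' x w v"
  \<comment> \<open>Half the supposed gap: two errors below \<open>e\<close> cannot add up to
    it.\<close>
  define e where "e = \<bar>f'' x v w - f'' x w v\<bar> / 2"
  have "e > 0" using ne by (simp add: e_def)
  have lim: "((\<lambda>y. f'' y a b) \<longlongrightarrow> f'' x a b) (at x)" for a b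
    using cont by (intro tendsto_intros) (auto simp: continuous_on_def)
  have near: "\<exists>d>0. \<forall>y. dist y x < d \<longrightarrow> \<bar>f'' y a b - f'' x a b\<bar> < e" for a b
  proof -
    obtain d where d: "d > 0" "\<And>y. y \<noteq> x \<Longrightarrow> dist y x < d \<Longrightarrow> \<bar>f'' y a b - f'' x a b\<bar> < e"
      using tendstoD[OF lim[of a b] \<open>e > 0\<close>] unfolding eventually_at dist_real_def by blast
    then have "\<bar>f'' y a b - f'' x a b\<bar> < e" if "dist y x < d" for y
      using that \<open>e > 0\<close> by (cases "y = x") auto
    then show ?thesis using \<open>d > 0\<close> by blast
  qed
  obtain d1 where d1: "d1 > 0" "\<And>y. dist y x < d1 \<Longrightarrow> \<bar>f'' y v w - f'' x v w\<bar> < e"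
    using near by blast
  obtain d2 where d2: "d2 > 0" "\<And>y. dist y x < d2 \<Longrightarrow> \<bar>f'' y w v - f'' x w v\<bar> < e"
    using near by blast
  \<comment> \<open>Small enough that both mean value points are within \<open>min d1 d2\<close> of
    \<open>x\<close>. The factor 2 makes the bound strict, and the summand 1 keeps the denominator
    positive when \<open>v\<close> and \<open>w\<close> vanish.\<close>
  define h where "h = min d1 d2 / (2 * (norm v + norm w + 1))"
  have pos: "0 < norm v + norm w + 1" by (simp add: add_nonneg_pos)
  have "h > 0" unfolding h_def using d1 d2 pos by simp
  have "h * (norm v + norm w) \<le> h * (norm v + norm w + 1)"
    using \<open>h > 0\<close> by simp
  also have "\<dots> = min d1 d2 / 2" using pos unfolding h_def by (simp add: field_simps)
  also have "\<dots> < min d1 d2" using d1(1) d2(1) by (simp add: min_def)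
  finally have small: "h * (norm v + norm w) < min d1 d2" .
  obtain y where y: "norm (y - x) \<le> h * (norm v + norm w)"
    "f (x + h *\<^sub>R v + h *\<^sub>R w) - f (x + h *\<^sub>R v) - f (x + h *\<^sub>R w) + f x = h * h * f'' y w v"
    by (rule second_difference_mean_value[OF f' f'' \<open>h > 0\<close>])
  obtain z where z: "norm (z - x) \<le> h * (norm w + norm v)"
    "f (x + h *\<^sub>R w + h *\<^sub>R v) - f (x + h *\<^sub>R w) - f (x + h *\<^sub>R v) + f x = h * h * f'' z v w"
    by (rule second_difference_mean_value[OF f' f'' \<open>h > 0\<close>])
  have c: "x + h *\<^sub>R w + h *\<^sub>R v = x + h *\<^sub>R v + h *\<^sub>R w" by (simp add: algebra_simps)
  have "h * h * f'' z v w = h * h * f'' y w v"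
    using y(2) z(2) unfolding c by linarith
  then have "f'' z v w = f'' y w v" using \<open>h > 0\<close> by simp
  moreover have "\<bar>f'' z v w - f'' x v w\<bar> < e" "\<bar>f'' y w v - f'' x w v\<bar> < e"
    using d1(2)[of z] d2(2)[of y] y(1) z(1) small by (auto simp: dist_norm add.commute)
  moreover have "\<bar>a - b\<bar> \<le> \<bar>c - a\<bar> + \<bar>c - b\<bar>" for a b c :: real by linarith
  ultimately have "\<bar>f'' x v w - f'' x w v\<bar> < 2 * e" by (smt (verit))
  then show False unfolding e_def by simp
qed

text \<open>The scalar case applies to each component \<open>f x \<bullet> b\<close>, whose
  derivatives are those of \<open>f\<close> followed by the inner product with
  \<open>b\<close>.\<close>

lemma symmetric_second_derivative:
  fixes f :: "'a::real_normed_vector \<Rightarrow> 'b::euclidean_space"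
  assumes f': "\<And>x. (f has_derivative blinfun_apply (f' x)) (at x)"
    and f'': "\<And>x. (f' has_derivative blinfun_apply (f'' x)) (at x)"
    and cont: "continuous_on UNIV f''"
  shows "f'' x v w = f'' x w v"
proof (rule euclidean_eqI)
  fix b :: 'b assume "b \<in> Basis"
  have 1: "((\<lambda>x. f x \<bullet> b) has_derivative blinfun_apply (blinfun_inner_left b o\<^sub>L f' x)) (at x)" for x
    using has_derivative_inner_left[OF f'[of x], of b] by (simp add: blinfun_compose.rep_eq o_def)
  let ?B = "\<lambda>g. blinfun_inner_left b o\<^sub>L (g :: 'a \<Rightarrow>\<^sub>L 'b)"
  have blB: "bounded_linear ?B" by (intro bounded_linear_intros)
  have 2: "((\<lambda>x. ?B (f' x)) has_derivative blinfun_apply (Blinfun ?B o\<^sub>L f'' x)) (at x)" for x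
    using bounded_linear.has_derivative[OF blB f''[of x]]
    by (simp add: bounded_linear_Blinfun_apply[OF blB] blinfun_compose.rep_eq o_def)
  have 3: "continuous_on UNIV (\<lambda>x. Blinfun ?B o\<^sub>L f'' x)"
    by (intro continuous_intros cont)
  show "f'' x v w \<bullet> b = f'' x w v \<bullet> b"
    using symmetric_second_derivative_real[OF 1 2 3, of x v w]
    by (simp add: bounded_linear_Blinfun_apply[OF blB])
qed

lemma C1_difference_bound:
  fixes f :: "'a::real_normed_vector \<Rightarrow> real"
  assumes f: "C1 f" and K: "compact K" "convex K"
  obtains C where "C \<ge> 0" "\<And>z v. z \<in> K \<Longrightarrow> z + v \<in> K \<Longrightarrow> \<bar>f (z + v) - f z\<bar> \<le> C * norm v"
proof -
  obtain f' where f': "\<And>x. (f has_derivative blinfun_apply (f' x)) (at x)" "continuous_on UNIV f'"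
    using f by (auto simp: C1_def)
  have "bounded (f' ` K)"
    using f'(2) K(1) by (meson compact_continuous_image compact_imp_bounded continuous_on_subset subset_UNIV)
  then obtain C where C: "\<And>x. x \<in> K \<Longrightarrow> norm (f' x) \<le> C" "C > 0"
    unfolding bounded_pos by auto
  show thesis
  proof (rule that[of C])
    fix z v assume zv: "z \<in> K" "z + v \<in> K"
    obtain t where t: "0 < t" "t < 1" "f (z + 1 *\<^sub>R v) - f (z + 0 *\<^sub>R v) = (1 - 0) * f' (z + t *\<^sub>R v) v"
      using MVT2[OF zero_less_one has_real_derivative_along_line[OF f'(1)], of z v] by blast
    have "z + t *\<^sub>R v = (1 - t) *\<^sub>R z + t *\<^sub>R (z + v)" by (simp add: algebra_simps)
    then have "z + t *\<^sub>R v \<in> K" using K(2) zv t by (simp add: convex_alt)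
    then have "norm (f' (z + t *\<^sub>R v) v) \<le> C * norm v"
      using C(1) by (meson mult_right_mono norm_blinfun norm_ge_zero order_trans)
    then show "\<bar>f (z + v) - f z\<bar> \<le> C * norm v" using t(3) by simp
  qed (use C in simp)
qed

text \<open>First order terms cancel between \<open>v\<close> and \<open>- v\<close>. The mean value
  theorem for \<open>f (z + t v) + f (z - t v)\<close> leaves a difference of first derivatives at
  opposite points, and a second application turns it into a second derivative.\<close>

lemma C2_second_difference_bound:
  fixes f :: "'a::real_normed_vector \<Rightarrow> real"
  assumes f: "C2 f" and K: "compact K" "convex K"
  obtains C where "C \<ge> 0" "\<And>z v. z + v \<in> K \<Longrightarrow> z - v \<in> K \<Longrightarrow> \<bar>2 * f z - f (z + v) - f (z - v)\<bar> \<le> C * norm v ^ 2"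
proof -
  obtain f' where f': "\<And>x. (f has_derivative blinfun_apply (f' x)) (at x)" "C1 f'"
    using f by (auto simp: C2_def)
  obtain f'' where f'': "\<And>x. (f' has_derivative blinfun_apply (f'' x)) (at x)" "continuous_on UNIV f''"
    using f'(2) by (auto simp: C1_def)
  have "bounded (f'' ` K)"
    using f''(2) K(1) by (meson compact_continuous_image compact_imp_bounded continuous_on_subset subset_UNIV)
  then obtain C where C: "\<And>x. x \<in> K \<Longrightarrow> norm (f'' x) \<le> C" "C > 0"
    unfolding bounded_pos by auto
  show thesis
  \<comment> \<open>The second application runs over the interval from \<open>- t\<close> to
    \<open>t\<close>, whose length is below 2.\<close>
  proof (rule that[of "2 * C"])
    fix z v assume zv: "z + v \<in> K" "z - v \<in> K"
    have inK: "z + t *\<^sub>R v \<in> K" if "\<bar>t\<bar> \<le> 1" for t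
    proof -
      have "z + t *\<^sub>R v = (1 - (1 - t) / 2) *\<^sub>R (z + v) + ((1 - t) / 2) *\<^sub>R (z - v)"
        by (simp add: algebra_simps) (simp add: scaleR_left_distrib[symmetric] field_simps)
      moreover have "0 \<le> (1 - t) / 2" "(1 - t) / 2 \<le> 1" using that by auto
      ultimately show ?thesis using K(2) zv unfolding convex_alt by metis
    qed
    have d1: "((\<lambda>t. f (z + t *\<^sub>R v) + f (z + t *\<^sub>R (- v))) has_real_derivative
        f' (z + t *\<^sub>R v) v + f' (z + t *\<^sub>R (- v)) (- v)) (at t)" for t
      by (intro DERIV_add has_real_derivative_along_line f')
    obtain t where t: "0 < t" "t < 1" "(f (z + 1 *\<^sub>R v) + f (z + 1 *\<^sub>R (- v))) - (f (z + 0 *\<^sub>R v) + f (z + 0 *\<^sub>R (- v)))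
        = (1 - 0) * (f' (z + t *\<^sub>R v) v + f' (z + t *\<^sub>R (- v)) (- v))"
      using MVT2[OF zero_less_one d1] by blast
    let ?B = "\<lambda>x. Blinfun (\<lambda>w. f'' x w v)"
    have ap: "blinfun_apply (?B x) = (\<lambda>w. f'' x w v)" for x
      by (subst bounded_linear_Blinfun_apply) (auto intro!: bounded_linear_intros)
    have d2: "((\<lambda>x. f' x v) has_derivative blinfun_apply (?B x)) (at x)" for x
      unfolding ap by (rule bounded_linear.has_derivative[OF blinfun.bounded_linear_left f''(1)])
    have "- t < t" using t by simp
    then obtain r where r: "- t < r" "r < t"
      "f' (z + t *\<^sub>R v) v - f' (z + (- t) *\<^sub>R v) v = (t - (- t)) * f'' (z + r *\<^sub>R v) v v"
      using MVT2[OF _ has_real_derivative_along_line[OF d2, of z v]] unfolding ap by blast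
    have "norm (f'' (z + r *\<^sub>R v) v v) \<le> norm (f'' (z + r *\<^sub>R v)) * norm v * norm v"
      by (meson mult_right_mono norm_blinfun norm_ge_zero order_trans)
    also have "\<dots> \<le> C * norm v * norm v"
      using C(1)[OF inK, of r] r t by (intro mult_right_mono) auto
    finally have b: "\<bar>f'' (z + r *\<^sub>R v) v v\<bar> \<le> C * norm v ^ 2" by (simp add: power2_eq_square)
    have eq: "2 * f z - f (z + v) - f (z - v) = - (2 * t * f'' (z + r *\<^sub>R v) v v)"
      using t(3) r(3) by (simp add: blinfun.minus_right)
    have "\<bar>2 * t * f'' (z + r *\<^sub>R v) v v\<bar> = 2 * (t * \<bar>f'' (z + r *\<^sub>R v) v v\<bar>)"
      using t by (simp add: abs_mult)
    also have "\<dots> \<le> 2 * (1 * (C * norm v ^ 2))"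
      using t b by (intro mult_left_mono mult_mono) auto
    finally show "\<bar>2 * f z - f (z + v) - f (z - v)\<bar> \<le> 2 * C * norm v ^ 2" by (simp add: eq)
  qed (use C in simp)
qed

subsection \<open>The Maurer-Cartan form\<close>

text \<open>Induction lowers the power: if \<open>A ^^ Suc k\<close> kills the curve, then
  \<open>(A ^^ k) (\<eta> t)\<close> has derivative 0, so it is constant and equal to its value 0 at
  the origin. Nilpotency thus yields uniqueness by elementary means.\<close>

lemma nilpotent_linear_ode_zero:
  fixes \<eta> :: "real \<Rightarrow> 'a::real_normed_vector"
  assumes A: "bounded_linear A" and \<eta>: "\<And>t. (\<eta> has_vector_derivative - A (\<eta> t)) (at t)"
    and 0: "\<eta> 0 = 0" and nil: "\<And>t. (A ^^ k) (\<eta> t) = 0"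
  shows "\<eta> t = 0"
  using nil
proof (induction k arbitrary: t)
  case (Suc k)
  have bl: "bounded_linear (A ^^ k)" for k
    by (induction k) (auto intro: bounded_linear_compose[OF A, unfolded o_def] simp: o_def id_def)
  interpret Ak: bounded_linear "A ^^ k" by (rule bl)
  have "((\<lambda>t. (A ^^ k) (\<eta> t)) has_vector_derivative (A ^^ k) (- A (\<eta> t))) (at t)" for t
    by (rule Ak.has_vector_derivative[OF \<eta>])
  moreover have "(A ^^ k) (- A (\<eta> t)) = 0" for t
    using Suc.prems[of t] by (simp add: linear_neg[OF bounded_linear.linear[OF bl]] funpow_swap1)
  ultimately have "((\<lambda>t. (A ^^ k) (\<eta> t)) has_derivative (\<lambda>h. 0)) (at t within UNIV)" for t
    by (simp add: has_vector_derivative_def)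
  then have "\<exists>c. \<forall>t\<in>UNIV. (A ^^ k) (\<eta> t) = c"
    by (intro has_derivative_zero_constant) auto
  then have "(A ^^ k) (\<eta> t) = (A ^^ k) (\<eta> 0)" for t by auto
  then have "(A ^^ k) (\<eta> t) = 0" for t by (simp add: 0 Ak.zero)
  then show ?case by (rule Suc.IH)
qed simp

section \<open>The group law in exponential coordinates and its first two derivatives\<close>

locale homogeneous =
  fixes E :: "'a::euclidean_space \<Rightarrow> 'g::topological_group_add"
    and \<Delta> :: "real \<Rightarrow> 'a \<Rightarrow> 'a" and n :: nat and X :: "nat \<Rightarrow> 'a" and d :: "nat \<Rightarrow> real"
  assumes homogeneous: "homogeneous_group E \<Delta> n X d"
begin

lemma lie: "lie_group_exp E"
  using homogeneous by (simp add: homogeneous_group_def)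

lemma homeo: "homeomorphism UNIV UNIV E (inv E)"
  using lie by (simp add: lie_group_exp_def)

lemma inv_E [simp]: "inv E (E p) = p" and E_inv [simp]: "E (inv E g) = g"
  using homeo by (auto simp: homeomorphism_def)

lemma continuous_E: "continuous_on UNIV E" and continuous_inv_E: "continuous_on UNIV (inv E)"
  using homeo by (auto simp: homeomorphism_def)

lemma E_eq_iff: "E p = E q \<longleftrightarrow> p = q"
  by (metis inv_E)

lemma E_scaleR_add: "E ((s + t) *\<^sub>R p) = E (s *\<^sub>R p) + E (t *\<^sub>R p)"
  using lie by (simp add: lie_group_exp_def)

lemma E_0 [simp]: "E 0 = 0"
  using E_scaleR_add[of 0 0 0] by (metis add.right_neutral add_left_imp_eq scaleR_zero_right)

lemma E_minus [simp]: "E (- p) = - E p"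
proof -
  have "E p + E (- p) = 0"
    using E_scaleR_add[of 1 "-1" p] by simp
  then show ?thesis by (metis minus_unique)
qed

text \<open>This is the Baker-Campbell-Hausdorff product on the Lie algebra. Identity and inverse
  become \<open>0\<close> and \<open>- p\<close>.\<close>

definition mul :: "'a \<Rightarrow> 'a \<Rightarrow> 'a" where
  "mul p q = inv E (E p + E q)"

lemma E_mul [simp]: "E (mul p q) = E p + E q"
  by (simp add: mul_def)

lemma mul_assoc: "mul (mul p q) r = mul p (mul q r)"
  by (simp add: mul_def add.assoc)

lemma mul_0 [simp]: "mul 0 p = p" "mul p 0 = p"
  by (simp_all add: mul_def)

lemma mul_minus [simp]: "mul (- p) p = 0" "mul p (- p) = 0"
  by (simp_all add: E_eq_iff[symmetric])

lemma mul_minus_cancel [simp]: "mul (- p) (mul p q) = q" "mul p (mul (- p) q) = q"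
  by (simp_all add: mul_assoc[symmetric])

lemma minus_mul: "- mul p q = mul (- q) (- p)"
  by (simp add: E_eq_iff[symmetric] minus_add)

lemma mul_scaleR: "mul (s *\<^sub>R p) (t *\<^sub>R p) = (s + t) *\<^sub>R p"
  by (simp add: E_eq_iff[symmetric] E_scaleR_add)

lemma C2_mul: "C2 (\<lambda>z. mul (fst z) (snd z))"
  unfolding mul_def using lie by (intro smooth_on_UNIV_C2) (simp add: lie_group_exp_def)

definition mul' :: "'a \<times> 'a \<Rightarrow> ('a \<times> 'a) \<Rightarrow>\<^sub>L 'a" where
  "mul' = (SOME f'. (\<forall>z. ((\<lambda>z. mul (fst z) (snd z)) has_derivative blinfun_apply (f' z)) (at z)) \<and> C1 f')"

lemma mul'_spec: "(\<forall>z. ((\<lambda>z. mul (fst z) (snd z)) has_derivative blinfun_apply (mul' z)) (at z)) \<and> C1 mul'"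
  using C2_mul unfolding C2_def mul'_def by (rule someI_ex)

lemma has_derivative_mul: "((\<lambda>z. mul (fst z) (snd z)) has_derivative blinfun_apply (mul' z)) (at z)"
  and C1_mul': "C1 mul'"
  using mul'_spec by blast+

lemma continuous_mul': "continuous_on UNIV mul'"
  by (rule C1_continuous[OF C1_mul'])

text \<open>In \<open>mul'' z v w\<close> the vector \<open>v\<close> is the direction in which
  \<open>mul'\<close> is differentiated, and \<open>w\<close> is the argument of the resulting
  linear map.\<close>

definition mul'' :: "'a \<times> 'a \<Rightarrow> ('a \<times> 'a) \<Rightarrow>\<^sub>L (('a \<times> 'a) \<Rightarrow>\<^sub>L 'a)" where
  "mul'' = (SOME f'. (\<forall>z. (mul' has_derivative blinfun_apply (f' z)) (at z)) \<and> continuous_on UNIV f')"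

lemma mul''_spec: "(\<forall>z. (mul' has_derivative blinfun_apply (mul'' z)) (at z)) \<and> continuous_on UNIV mul''"
  using C1_mul' unfolding C1_def mul''_def by (rule someI_ex)

lemma has_derivative_mul': "(mul' has_derivative blinfun_apply (mul'' z)) (at z)"
  using mul''_spec by blast

lemma mul''_symmetric: "mul'' z v w = mul'' z w v"
  using mul''_spec by (intro symmetric_second_derivative[OF has_derivative_mul has_derivative_mul']) blast

lemma has_vector_derivative_mul:
  assumes "(f has_vector_derivative v) (at t)" "(g has_vector_derivative w) (at t)"
  shows "((\<lambda>s. mul (f s) (g s)) has_vector_derivative mul' (f t, g t) (v, w)) (at t)"
proof -
  have "((\<lambda>s. (f s, g s)) has_vector_derivative (v, w)) (at t)"
    using assms by (rule has_vector_derivative_Pair)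
  from has_derivative_compose[OF this[unfolded has_vector_derivative_def] has_derivative_mul]
  show ?thesis
    by (simp add: has_vector_derivative_def blinfun.scaleR_right del: scaleR_Pair)
qed

lemma has_vector_derivative_linear_path: "((\<lambda>s. p + s *\<^sub>R v) has_vector_derivative v) (at t)"
  by (auto intro!: derivative_eq_intros)

text \<open>Associativity, differentiated in the last two factors with the first one held
  fixed.\<close>

lemma mul'_compose:
  "mul' (p, mul q r) (0, mul' (q, r) (v, w)) = mul' (mul p q, r) (mul' (p, q) (0, v), w)"
proof -
  note path = has_vector_derivative_linear_path[of _ _ 0]
  have "((\<lambda>s. mul p (mul (q + s *\<^sub>R v) (r + s *\<^sub>R w))) has_vector_derivative
      mul' (p, mul q r) (0, mul' (q, r) (v, w))) (at 0)"
    using has_vector_derivative_mul[OF has_vector_derivative_const[of p]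
        has_vector_derivative_mul[OF path[of q v] path[of r w]]] by simp
  moreover have "((\<lambda>s. mul (mul p (q + s *\<^sub>R v)) (r + s *\<^sub>R w)) has_vector_derivative
      mul' (mul p q, r) (mul' (p, q) (0, v), w)) (at 0)"
    using has_vector_derivative_mul[OF has_vector_derivative_mul[OF
        has_vector_derivative_const[of p] path[of q v]] path[of r w]] by simp
  ultimately show ?thesis
    by (simp add: mul_assoc vector_derivative_unique_at)
qed

lemma mul'_zero_left: "mul' (0, q) (0, v) = v"
  using vector_derivative_unique_at[OF has_vector_derivative_mul[OF has_vector_derivative_const
      has_vector_derivative_linear_path[of q v 0]]] has_vector_derivative_linear_path[of q v 0]
  by simp

lemma mul'_zero_right: "mul' (p, 0) (v, 0) = v"
  using vector_derivative_unique_at[OF has_vector_derivative_mul[OF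
      has_vector_derivative_linear_path[of p v 0] has_vector_derivative_const]]
    has_vector_derivative_linear_path[of p v 0]
  by simp

lemma has_vector_derivative_mul':
  assumes "(f has_vector_derivative v) (at t)" "(w has_vector_derivative w') (at t)"
  shows "((\<lambda>s. mul' (f s) (w s)) has_vector_derivative mul'' (f t) v (w t) + mul' (f t) w') (at t)"
proof -
  have "((\<lambda>s. mul' (f s)) has_derivative (\<lambda>h. mul'' (f t) (h *\<^sub>R v))) (at t)"
    using assms(1) by (intro has_derivative_compose[OF _ has_derivative_mul'])
      (simp add: has_vector_derivative_def)
  from blinfun.FDERIV[OF this assms(2)[unfolded has_vector_derivative_def]]
  show ?thesis
    by (simp add: has_vector_derivative_def blinfun.scaleR_right blinfun.scaleR_left
        scaleR_right_distrib add.commute)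
qed

lemma has_vector_derivative_axes:
  "((\<lambda>s. (0 :: 'a, s *\<^sub>R v)) has_vector_derivative (0, v :: 'a)) (at t)"
  "((\<lambda>s. (- (s *\<^sub>R v), s *\<^sub>R v)) has_vector_derivative (- v :: 'a, v)) (at t)"
  by (intro has_vector_derivative_Pair; auto intro!: derivative_eq_intros)+

text \<open>Multiplication by the identity on the left is the identity map, so its derivative in the
  second factor does not vary with the base point.\<close>

lemma mul''_00_left: "mul'' (0, 0) (0, v) (0, w) = 0"
proof -
  have "((\<lambda>s. mul' (0, s *\<^sub>R v) (0, w)) has_vector_derivative mul'' (0, 0) (0, v) (0, w)) (at 0)"
    using has_vector_derivative_mul'[OF has_vector_derivative_axes(1)[of v 0] has_vector_derivative_const[of "(0, w)"]]
    by simp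
  then have "((\<lambda>s. w) has_vector_derivative mul'' (0, 0) (0, v) (0, w)) (at (0::real))"
    by (simp add: mul'_zero_left)
  then show ?thesis
    using vector_derivative_unique_at[OF _ has_vector_derivative_const] by blast
qed

lemma left_invariant_field_eq: "left_invariant_field E Y p = mul' (p, 0) (0, Y)"
  unfolding left_invariant_field_def
  using has_vector_derivative_mul[OF has_vector_derivative_const[of p] has_vector_derivative_linear_path[of 0 Y 0]]
  by (simp add: vector_derivative_at mul_def)

text \<open>A left-invariant field is the derivative of the product in its second factor at the
  identity. Differentiating once more in the first factor shows the bracket to be the
  antisymmetrized mixed second derivative of the group law.\<close>

lemma lie_bracket_eq: "lie_bracket E Y Z = mul'' (0, 0) (Y, 0) (0, Z) - mul'' (0, 0) (Z, 0) (0, Y)"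
proof -
  have "frechet_derivative (left_invariant_field E Z) (at 0) Y = mul'' (0, 0) (Y, 0) (0, Z)" for Y Z
  proof -
    have "((\<lambda>p. mul' (p, 0)) has_derivative (\<lambda>h. mul'' (0, 0) (h, 0))) (at 0)"
      by (rule has_derivative_compose[OF _ has_derivative_mul', of "\<lambda>p. (p, 0)"])
         (auto intro!: derivative_eq_intros)
    then have "((\<lambda>p. mul' (p, 0) (0, Z)) has_derivative (\<lambda>h. mul'' (0, 0) (h, 0) (0, Z))) (at 0)"
      by (rule bounded_linear.has_derivative[OF blinfun.bounded_linear_left])
    then show ?thesis
      unfolding left_invariant_field_eq[abs_def]
      by (metis frechet_derivative_at)
  qed
  then show ?thesis by (simp add: lie_bracket_def)
qed

lemma bounded_linear_lie_bracket: "bounded_linear (lie_bracket E p)"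
proof -
  have 1: "bounded_linear (\<lambda>v::'a. (0::'a, v))" "bounded_linear (\<lambda>v::'a. (v, 0::'a))"
    by (intro bounded_linear_intros)+
  show ?thesis
    unfolding lie_bracket_eq[abs_def]
    by (intro bounded_linear_sub bounded_linear_compose[OF blinfun.bounded_linear_right 1(1)]
       bounded_linear_compose[OF blinfun.bounded_linear_left] bounded_linear_compose[OF blinfun.bounded_linear_right 1(2)])
qed

text \<open>Each application of \<open>lie_bracket E p\<close> descends one step in the lower
  central series, which reaches \<open>{0}\<close>.\<close>

lemma lie_bracket_nilpotent: "\<exists>k. \<forall>Y. (lie_bracket E p ^^ k) Y = 0"
proof -
  obtain k where k: "lower_central_series E k = {0}"
    using homogeneous by (auto simp: homogeneous_group_def nilpotent_lie_def)
  have "(lie_bracket E p ^^ j) Y \<in> lower_central_series E j" for j Y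
    by (induction j) (auto intro!: span_base)
  then show ?thesis using k by blast
qed

text \<open>\<open>maurer_cartan\<close> is the left Maurer-Cartan form in the chart; \<open>radial p t\<close> is \<open>t\<close> times its
  value at \<open>t p\<close>, that is, \<open>v \<mapsto> d/ds exp (- t p) exp (t (p + s v))\<close> at \<open>s = 0\<close>.\<close>

definition maurer_cartan :: "'a \<Rightarrow> 'a \<Rightarrow> 'a" where
  "maurer_cartan p v = mul' (- p, p) (0, v)"

definition radial :: "'a \<Rightarrow> real \<Rightarrow> 'a \<Rightarrow> 'a" where
  "radial p t v = maurer_cartan (t *\<^sub>R p) (t *\<^sub>R v)"

section \<open>Left invariance of the Maurer-Cartan form and its equation along rays\<close>

lemma bounded_linear_maurer_cartan: "bounded_linear (maurer_cartan p)"
proof -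
  have 1: "bounded_linear (\<lambda>v::'a. (0::'a, v))"
    by (intro bounded_linear_intros)
  show ?thesis
    unfolding maurer_cartan_def[abs_def] by (rule bounded_linear_compose[OF blinfun.bounded_linear_right 1])
qed

lemma maurer_cartan_0: "maurer_cartan 0 v = v"
  by (simp add: maurer_cartan_def mul'_zero_left)

text \<open>The inverse of \<open>mul a p\<close> ends in the inverse of \<open>a\<close>, which
  cancels the translation by \<open>a\<close>; \<open>mul'_compose\<close> is this cancellation at
  the level of derivatives.\<close>

lemma maurer_cartan_mul: "maurer_cartan (mul a p) (mul' (a, p) (0, v)) = maurer_cartan p v"
  unfolding maurer_cartan_def mul'_compose by (simp add: minus_mul mul_assoc zero_prod_def[symmetric])

lemma tendsto_maurer_cartan:
  assumes "(f \<longlongrightarrow> p) F"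
  shows "((\<lambda>x. maurer_cartan (f x) v) \<longlongrightarrow> maurer_cartan p v) F"
proof -
  have "isCont mul' (- p, p)"
    using continuous_mul' by (simp add: continuous_on_eq_continuous_at)
  then have "((\<lambda>x. mul' (- f x, f x)) \<longlongrightarrow> mul' (- p, p)) F"
    by (rule isCont_tendsto_compose) (intro tendsto_intros assms)
  then show ?thesis
    unfolding maurer_cartan_def by (intro tendsto_intros)
qed

text \<open>Since rays are one-parameter subgroups,
  \<open>exp (- (t + \<tau>) p) exp ((t + \<tau>) q)\<close> equals
  \<open>exp (- \<tau> p) (exp (- t p) exp (t q)) exp (\<tau> q)\<close>. Differentiating in
  \<open>q\<close> at \<open>q = p\<close> gives a conjugate of \<open>radial p t\<close> plus the
  contribution of the last factor. This reduces the derivative at every time to the derivative at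
  0.\<close>

lemma radial_add:
  "radial p (t + \<tau>) v =
    mul' (- (\<tau> *\<^sub>R p), \<tau> *\<^sub>R p) (0, mul' (0, \<tau> *\<^sub>R p) (radial p t v, 0)) + radial p \<tau> v"
proof -
  have ray: "((\<lambda>s. t *\<^sub>R (p + s *\<^sub>R v)) has_vector_derivative t *\<^sub>R v) (at 0)" for t
    by (auto intro!: derivative_eq_intros)
  have rad: "((\<lambda>s. mul (- (t *\<^sub>R p)) (t *\<^sub>R (p + s *\<^sub>R v))) has_vector_derivative radial p t v) (at 0)" for t
    using has_vector_derivative_mul[OF has_vector_derivative_const[of "- (t *\<^sub>R p)"] ray[of t]]
    by (simp add: radial_def maurer_cartan_def)
  have eq: "mul (- (\<tau> *\<^sub>R p)) (mul (mul (- (t *\<^sub>R p)) (t *\<^sub>R q)) (\<tau> *\<^sub>R q))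
      = mul (- ((t + \<tau>) *\<^sub>R p)) ((t + \<tau>) *\<^sub>R q)" for q
  proof -
    have "- ((t + \<tau>) *\<^sub>R p) = mul (- (\<tau> *\<^sub>R p)) (- (t *\<^sub>R p))"
      by (simp add: mul_scaleR minus_mul[symmetric])
    moreover have "(t + \<tau>) *\<^sub>R q = mul (t *\<^sub>R q) (\<tau> *\<^sub>R q)"
      by (simp add: mul_scaleR)
    ultimately show ?thesis by (simp add: mul_assoc)
  qed
  have "((\<lambda>s. mul (- (\<tau> *\<^sub>R p)) (mul (mul (- (t *\<^sub>R p)) (t *\<^sub>R (p + s *\<^sub>R v))) (\<tau> *\<^sub>R (p + s *\<^sub>R v))))
      has_vector_derivative mul' (- (\<tau> *\<^sub>R p), \<tau> *\<^sub>R p) (0, mul' (0, \<tau> *\<^sub>R p) (radial p t v, \<tau> *\<^sub>R v))) (at 0)"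
    using has_vector_derivative_mul[OF has_vector_derivative_const[of "- (\<tau> *\<^sub>R p)"]
        has_vector_derivative_mul[OF rad[of t] ray[of \<tau>]]] by simp
  then have "radial p (t + \<tau>) v = mul' (- (\<tau> *\<^sub>R p), \<tau> *\<^sub>R p) (0, mul' (0, \<tau> *\<^sub>R p) (radial p t v, \<tau> *\<^sub>R v))"
    using vector_derivative_unique_at[OF rad[of "t + \<tau>"]] by (simp only: eq)
  moreover have "mul' (0, \<tau> *\<^sub>R p) (radial p t v, \<tau> *\<^sub>R v) = mul' (0, \<tau> *\<^sub>R p) (radial p t v, 0) + \<tau> *\<^sub>R v"
    using blinfun.add_right[of "mul' (0, \<tau> *\<^sub>R p)" "(radial p t v, 0)" "(0, \<tau> *\<^sub>R v)"]
    by (simp add: mul'_zero_left)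
  moreover have "mul' z (0, a + b) = mul' z (0, a) + mul' z (0, b)" for z a b
    using blinfun.add_right[of "mul' z" "(0, a)" "(0, b)"] by simp
  ultimately show ?thesis
    by (simp add: radial_def maurer_cartan_def)
qed

lemma has_vector_derivative_radial_0: "((\<lambda>t. radial p t v) has_vector_derivative v) (at 0)"
proof -
  have bl: "radial p t v = t *\<^sub>R maurer_cartan (t *\<^sub>R p) v" for t
    unfolding radial_def using bounded_linear_maurer_cartan by (simp add: linear_simps)
  have "((\<lambda>t. maurer_cartan (t *\<^sub>R p) v) has_vector_derivative mul'' (0, 0) (- p, p) (0, v)) (at 0)"
    using has_vector_derivative_mul'[OF has_vector_derivative_axes(2)[of p 0] has_vector_derivative_const[of "(0, v)"]]
    by (simp add: maurer_cartan_def)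
  from has_vector_derivative_scaleR[OF DERIV_ident this] show ?thesis
    by (simp add: bl maurer_cartan_0)
qed

text \<open>The identity \<open>radial_add\<close> is differentiated in \<open>\<tau>\<close> at 0:
  infinitesimal conjugation by \<open>exp (- \<tau> p)\<close> produces minus the bracket with
  \<open>p\<close>, and the last summand produces \<open>v\<close>.\<close>

lemma has_vector_derivative_radial:
  "((\<lambda>t. radial p t v) has_vector_derivative v - lie_bracket E p (radial p t v)) (at t)"
proof -
  let ?Y = "radial p t v"
  have 1: "((\<lambda>\<tau>. mul' (0, \<tau> *\<^sub>R p) (?Y, 0)) has_vector_derivative mul'' (0, 0) (0, p) (?Y, 0)) (at 0)"
    using has_vector_derivative_mul'[OF has_vector_derivative_axes(1)[of p 0] has_vector_derivative_const[of "(?Y, 0)"]]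
    by simp
  have "((\<lambda>\<tau>. mul' (- (\<tau> *\<^sub>R p), \<tau> *\<^sub>R p) (0, mul' (0, \<tau> *\<^sub>R p) (?Y, 0))) has_vector_derivative
     mul'' (0, 0) (- p, p) (0, ?Y) + mul' (0, 0) (0, mul'' (0, 0) (0, p) (?Y, 0))) (at 0)"
    using has_vector_derivative_mul'[OF has_vector_derivative_axes(2)[of p 0]
       has_vector_derivative_Pair[OF has_vector_derivative_const[of 0] 1]]
    by (simp add: mul'_zero_right)
  \<comment> \<open>The direction \<open>(- p, p)\<close> splits, and its part in the second factor
    contributes nothing by \<open>mul''_00_left\<close>. Symmetry of \<open>mul''\<close> brings the
    other term into the form in which it occurs in the bracket.\<close>
  moreover have "mul'' (0, 0) (- p, p) (0, ?Y) + mul' (0, 0) (0, mul'' (0, 0) (0, p) (?Y, 0)) = - lie_bracket E p ?Y"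
  proof -
    have "mul'' (0, 0) (- p, p) (0, ?Y) = mul'' (0, 0) (- (p, 0) + (0, p)) (0, ?Y)" by simp
    also have "\<dots> = - mul'' (0, 0) (p, 0) (0, ?Y)"
      unfolding blinfun.add_left blinfun.add_right blinfun.minus_left blinfun.minus_right
      by (simp add: mul''_00_left)
    finally show ?thesis
      by (simp add: mul'_zero_left lie_bracket_eq mul''_symmetric[of "(0, 0)" "(0, p)"])
  qed
  ultimately have "((\<lambda>\<tau>. radial p (t + \<tau>) v) has_vector_derivative - lie_bracket E p ?Y + v) (at 0)"
    unfolding radial_add by (simp only:) (intro has_vector_derivative_add has_vector_derivative_radial_0)
  then have "((\<lambda>\<tau>. radial p (t + \<tau>) v) has_vector_derivative v - lie_bracket E p ?Y) (at (t - t))"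
    by (simp add: add.commute)
  moreover have "((\<lambda>s. s - t) has_vector_derivative 1) (at t)"
    by (auto intro!: derivative_eq_intros)
  ultimately show ?thesis
    using vector_diff_chain_at[of "\<lambda>s. s - t" 1 t "\<lambda>\<tau>. radial p (t + \<tau>) v"] by (simp add: o_def)
qed

section \<open>Dilations and the determinant of left translations\<close>

lemma linear_\<Delta>: "l > 0 \<Longrightarrow> linear (\<Delta> l)"
  and \<Delta>_bracket: "l > 0 \<Longrightarrow> \<Delta> l (lie_bracket E Y Z) = lie_bracket E (\<Delta> l Y) (\<Delta> l Z)"
  using homogeneous by (auto simp: homogeneous_group_def lie_automorphism_def)

lemma \<Delta>_X: "l > 0 \<Longrightarrow> j \<in> {1..n} \<Longrightarrow> \<Delta> l (X j) = (l powr d j) *\<^sub>R X j"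
  using homogeneous by (auto simp: homogeneous_group_def)

lemma basis_X: "inj_on X {1..n}" "independent (X ` {1..n})" "span (X ` {1..n}) = UNIV"
  using homogeneous by (auto simp: homogeneous_group_def)

text \<open>Since \<open>\<Delta> l\<close> respects brackets, the discrepancy
  \<open>?\<eta>\<close> along the ray solves the homogeneous equation with coefficient
  \<open>lie_bracket E (\<Delta> l p)\<close> and starts at 0, so it vanishes; the claim is its
  value at time 1.\<close>

lemma maurer_cartan_\<Delta>:
  assumes l: "l > 0"
  shows "maurer_cartan (\<Delta> l p) (\<Delta> l v) = \<Delta> l (maurer_cartan p v)"
proof -
  have bl: "bounded_linear (\<Delta> l)"
    using linear_\<Delta>[OF l] by (simp add: linear_conv_bounded_linear)
  interpret br: bounded_linear "lie_bracket E (\<Delta> l p)" by (rule bounded_linear_lie_bracket)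
  let ?\<eta> = "\<lambda>t. radial (\<Delta> l p) t (\<Delta> l v) - \<Delta> l (radial p t v)"
  obtain k where k: "\<And>Y. (lie_bracket E (\<Delta> l p) ^^ k) Y = 0"
    using lie_bracket_nilpotent by blast
  have "?\<eta> 1 = 0"
  proof (rule nilpotent_linear_ode_zero[OF br.bounded_linear_axioms])
    show "(?\<eta> has_vector_derivative - lie_bracket E (\<Delta> l p) (?\<eta> t)) (at t)" for t
    proof (rule has_vector_derivative_eq_rhs)
      show "(?\<eta> has_vector_derivative (\<Delta> l v - lie_bracket E (\<Delta> l p) (radial (\<Delta> l p) t (\<Delta> l v))) -
         \<Delta> l (v - lie_bracket E p (radial p t v))) (at t)"
        by (intro has_vector_derivative_diff has_vector_derivative_radial bounded_linear.has_vector_derivative[OF bl])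
    qed (simp add: linear_diff[OF linear_\<Delta>[OF l]] \<Delta>_bracket[OF l] br.diff)
    show "?\<eta> 0 = 0"
      by (simp add: radial_def maurer_cartan_0 linear_0[OF linear_\<Delta>[OF l]])
  qed (rule k)
  then show ?thesis by (simp add: radial_def)
qed

lemma basis_X_expansion: obtains c where "p = (\<Sum>j = 1..n. c j *\<^sub>R X j)"
proof -
  have "p \<in> span (X ` {1..n})" using basis_X(3) by simp
  then obtain u where "p = (\<Sum>v\<in>X ` {1..n}. u v *\<^sub>R v)"
    by (auto simp: span_finite)
  then have "p = (\<Sum>j = 1..n. u (X j) *\<^sub>R X j)"
    unfolding sum.reindex[OF basis_X(1)] by simp
  then show thesis by (rule that)
qed

lemma \<Delta>_expansion:
  assumes "l > 0"
  shows "\<Delta> l (\<Sum>j = 1..n. c j *\<^sub>R X j) = (\<Sum>j = 1..n. (l powr d j * c j) *\<^sub>R X j)"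
  unfolding linear_sum[OF linear_\<Delta>[OF assms]] linear_scale[OF linear_\<Delta>[OF assms]]
  by (intro sum.cong refl) (simp add: \<Delta>_X[OF assms] mult.commute)

lemma d_ge_1: "j \<in> {1..n} \<Longrightarrow> 1 \<le> d j"
  using homogeneous unfolding homogeneous_group_def by (metis atLeastAtMost_iff order_refl)

lemma tendsto_\<Delta>_0: "((\<lambda>l. \<Delta> l p) \<longlongrightarrow> 0) (at_right 0)"
proof -
  obtain c where c: "p = (\<Sum>j = 1..n. c j *\<^sub>R X j)" by (rule basis_X_expansion)
  have "((\<lambda>l. l powr d j) \<longlongrightarrow> 0) (at_right 0)" if "j \<in> {1..n}" for j
    using d_ge_1[OF that] tendsto_powr2[of "\<lambda>l. l" "0::real" "at_right 0" "\<lambda>_. d j" "d j"]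
    by (auto simp: eventually_at_filter tendsto_ident_at)
  then have "((\<lambda>l. \<Sum>j = 1..n. (l powr d j * c j) *\<^sub>R X j) \<longlongrightarrow> (\<Sum>j = 1..n. (0 * c j) *\<^sub>R X j)) (at_right 0)"
    by (intro tendsto_intros) auto
  then have "((\<lambda>l. \<Sum>j = 1..n. (l powr d j * c j) *\<^sub>R X j) \<longlongrightarrow> 0) (at_right 0)" by simp
  then show ?thesis
    by (rule Lim_transform_eventually)
       (use eventually_at_right_less[of 0] in \<open>eventually_elim, simp only: c \<Delta>_expansion\<close>)
qed

lemma edet_\<Delta>: "l > 0 \<Longrightarrow> edet (\<Delta> l) = l powr (\<Sum>j = 1..n. d j)"
  using edet_eigenbasis[OF linear_\<Delta> basis_X \<Delta>_X] by (simp add: powr_sum)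

lemma edet_maurer_cartan: "edet (maurer_cartan p) = 1"
proof -
  have lin: "linear (maurer_cartan p)" for p
    using bounded_linear_maurer_cartan by (simp add: linear_conv_bounded_linear)
  have "edet (maurer_cartan (\<Delta> l p)) = edet (maurer_cartan p)" if l: "l > 0" for l
  proof -
    \<comment> \<open>The two values of the form are conjugate under the dilation, hence have equal
      determinants.\<close>
    have "maurer_cartan (\<Delta> l p) \<circ> \<Delta> l = \<Delta> l \<circ> maurer_cartan p"
      using maurer_cartan_\<Delta>[OF l] by auto
    then have "edet (maurer_cartan (\<Delta> l p)) * edet (\<Delta> l) = edet (\<Delta> l) * edet (maurer_cartan p)"
      by (metis edet_compose lin linear_\<Delta>[OF l])
    moreover have "edet (\<Delta> l) \<noteq> 0"
      using l by (simp add: edet_\<Delta>)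
    ultimately show ?thesis by simp
  qed
  then have "((\<lambda>l. edet (maurer_cartan (\<Delta> l p))) \<longlongrightarrow> edet (maurer_cartan p)) (at_right 0)"
    by (intro tendsto_eventually) (auto simp: eventually_at_filter)
  moreover have "((\<lambda>l. edet (maurer_cartan (\<Delta> l p))) \<longlongrightarrow> edet (maurer_cartan 0)) (at_right 0)"
    by (intro tendsto_edet tendsto_maurer_cartan tendsto_\<Delta>_0)
  moreover have "maurer_cartan 0 = id" by (auto simp: maurer_cartan_0)
  ultimately show ?thesis
    using tendsto_unique[of "at_right (0::real)"] by (auto simp: edet_id)
qed

lemma has_derivative_mul_left: "(mul a has_derivative (\<lambda>v. mul' (a, p) (0, v))) (at p)"
proof -
  have "(Pair a has_derivative Pair 0) (at p)"
    by (intro has_derivative_Pair has_derivative_const has_derivative_ident)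
  from has_derivative_compose[OF this has_derivative_mul] show ?thesis by simp
qed

text \<open>Left invariance relates the differential of a translation to two values of the
  Maurer-Cartan form, both of determinant one.\<close>

lemma edet_mul_left: "edet (\<lambda>v. mul' (a, p) (0, v)) = 1"
proof -
  have lin: "linear (maurer_cartan p)" for p
    using bounded_linear_maurer_cartan by (simp add: linear_conv_bounded_linear)
  have "maurer_cartan (mul a p) \<circ> (\<lambda>v. mul' (a, p) (0, v)) = maurer_cartan p"
    by (auto simp: maurer_cartan_mul)
  moreover have "linear (\<lambda>v. mul' (a, p) (0, v))"
    using has_derivative_mul_left by (rule has_derivative_linear)
  ultimately show ?thesis
    using edet_compose[OF lin] by (metis edet_maurer_cartan mult_1_left)
qed

end

subsection \<open>Haar measure and the homogeneous norm\<close>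

lemma lborel_distr_uminus_euclidean:
  "distr lborel borel uminus = (lborel :: 'a::euclidean_space measure)"
proof (rule lborel_eqI[symmetric])
  fix l u :: 'a
  assume le: "\<And>b. b \<in> Basis \<Longrightarrow> l \<bullet> b \<le> u \<bullet> b"
  have "uminus -` box l u = box (- u) (- l)"
    by (auto simp: mem_box less_minus_iff minus_less_iff)
  then have "emeasure (distr lborel borel uminus) (box l u) = emeasure lborel (box (- u) (- l))"
    by (subst emeasure_distr) auto
  also have "\<dots> = ennreal (\<Prod>b\<in>Basis. (u - l) \<bullet> b)"
    by (subst emeasure_lborel_box) (use le in \<open>auto simp: inner_diff_left\<close>)
  finally show "emeasure (distr lborel borel uminus) (box l u) = (\<Prod>b\<in>Basis. (u - l) \<bullet> b)"
    by simp
qed simp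

context homogeneous
begin

section \<open>Measurability and bi-invariance of the Haar measure\<close>

lemma continuous_mul: "continuous_on UNIV (\<lambda>z. mul (fst z) (snd z))"
  by (rule C1_continuous[OF C2_imp_C1[OF C2_mul]])

lemma continuous_mul_left: "continuous_on UNIV (mul a)"
  using has_derivative_mul_left has_derivative_continuous
  by (metis continuous_at_imp_continuous_on)

lemma measurable_E [measurable]: "E \<in> borel_measurable borel"
  by (rule borel_measurable_continuous_onI[OF continuous_E])

lemma measurable_inv_E [measurable]: "inv E \<in> borel_measurable borel"
  by (rule borel_measurable_continuous_onI[OF continuous_inv_E])

lemma sets_haar [simp, measurable_cong]: "sets (haar E) = sets borel"
  and space_haar [simp]: "space (haar E) = UNIV"
  by (simp_all add: haar_def)

text \<open>The type \<open>'g\<close> carries no second countability assumption, so joint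
  measurability is obtained in the chart, where the product of the Borel algebras is the Borel
  algebra of the product.\<close>

lemma measurable_group_add [measurable]:
  fixes f g :: "'b \<Rightarrow> 'g"
  assumes [measurable]: "f \<in> borel_measurable M" "g \<in> borel_measurable M"
  shows "(\<lambda>x. f x + g x) \<in> borel_measurable M"
proof -
  have *: "(\<lambda>x. (inv E (f x), inv E (g x))) \<in> M \<rightarrow>\<^sub>M (borel \<Otimes>\<^sub>M borel)" by measurable
  have "(\<lambda>z. mul (fst z) (snd z)) \<in> borel_measurable (borel \<Otimes>\<^sub>M borel)"
    using borel_measurable_continuous_onI[OF continuous_mul] by (simp add: borel_prod)
  from measurable_compose[OF measurable_compose[OF * this] measurable_E] show ?thesis by simp
qed

lemma measurable_group_uminus [measurable]:
  fixes f :: "'b \<Rightarrow> 'g"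
  assumes [measurable]: "f \<in> borel_measurable M"
  shows "(\<lambda>x. - f x) \<in> borel_measurable M"
proof -
  have "(\<lambda>x. E (- inv E (f x))) \<in> borel_measurable M" by measurable
  then show ?thesis by (simp only: E_minus E_inv)
qed

lemma measurable_group_diff [measurable]:
  fixes f g :: "'b \<Rightarrow> 'g"
  assumes [measurable]: "f \<in> borel_measurable M" "g \<in> borel_measurable M"
  shows "(\<lambda>x. f x - g x) \<in> borel_measurable M"
  unfolding diff_conv_add_uminus by measurable

text \<open>The preimage of a box under \<open>mul a\<close> is its image under the inverse
  translation \<open>mul (- a)\<close>, whose Jacobian is 1.\<close>

lemma distr_lborel_mul_left: "distr lborel borel (mul a) = lborel"
proof (rule lborel_eqI[symmetric])
  fix l u :: 'a
  assume le: "\<And>b. b \<in> Basis \<Longrightarrow> l \<bullet> b \<le> u \<bullet> b"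
  have meas [measurable]: "mul a \<in> borel_measurable borel"
    by (rule borel_measurable_continuous_onI[OF continuous_mul_left])
  have vim: "mul a -` box l u = mul (- a) ` box l u"
    by (auto simp: image_iff) (metis mul_minus_cancel(1))
  have "mul a -` box l u \<in> sets borel"
    using measurable_sets_borel[OF meas, of "box l u"] by simp
  then have "emeasure lborel (mul (- a) ` box l u) = ennreal 1 * emeasure lborel (box l u)"
    using le
    by (intro emeasure_image_edet[OF has_derivative_mul_left])
       (auto simp: edet_mul_left vim emeasure_lborel_box_eq intro!: inj_on_inverseI[of _ "mul a"])
  then show "emeasure (distr lborel borel (mul a)) (box l u) = (\<Prod>b\<in>Basis. (u - l) \<bullet> b)"
    using le by (subst emeasure_distr) (auto simp: vim)
qed simp

lemma distr_haar_left: "distr (haar E) borel (\<lambda>h. g + h) = haar E"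
proof -
  have [measurable]: "mul a \<in> borel_measurable borel" for a
    by (rule borel_measurable_continuous_onI[OF continuous_mul_left])
  have "distr (haar E) borel (\<lambda>h. g + h) = distr lborel borel (\<lambda>p. g + E p)"
    unfolding haar_def by (subst distr_distr) (auto simp: o_def)
  also have "(\<lambda>p. g + E p) = E \<circ> mul (inv E g)" by auto
  also have "distr lborel borel (E \<circ> mul (inv E g)) = distr (distr lborel borel (mul (inv E g))) borel E"
    by (subst distr_distr) auto
  finally show ?thesis by (simp add: distr_lborel_mul_left haar_def)
qed

lemma distr_haar_uminus: "distr (haar E) borel uminus = haar E"
proof -
  have "distr (haar E) borel uminus = distr lborel borel (\<lambda>p. - E p)"
    unfolding haar_def by (subst distr_distr) (auto simp: o_def intro: measurable_group_uminus)
  also have "(\<lambda>p. - E p) = E \<circ> uminus" by auto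
  also have "distr lborel borel (E \<circ> uminus) = distr (distr lborel borel uminus) borel E"
    by (subst distr_distr) auto
  finally show ?thesis by (simp add: lborel_distr_uminus_euclidean haar_def)
qed

text \<open>Inversion conjugates right translations into left translations, and both inversion and
  left translations preserve the measure.\<close>

lemma distr_haar_right: "distr (haar E) borel (\<lambda>h. h + g) = haar E"
proof -
  have [measurable]: "(uminus :: 'g \<Rightarrow> 'g) \<in> borel_measurable borel"
    using measurable_group_uminus[of "\<lambda>x. x" borel] by simp
  have "(\<lambda>h. h + g) = uminus \<circ> ((\<lambda>h. - g + h) \<circ> uminus)"
    by (auto simp: minus_add)
  then have "distr (haar E) borel (\<lambda>h. h + g) =
     distr (distr (distr (haar E) borel uminus) borel (\<lambda>h. - g + h)) borel uminus"
    by (simp add: distr_distr)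
  then show ?thesis by (simp add: distr_haar_left distr_haar_uminus)
qed

lemma sigma_finite_haar: "sigma_finite_measure (haar E)"
proof
  let ?A = "\<lambda>i::nat. inv E -` cball 0 (real i)"
  have sets: "?A i \<in> sets borel" for i
    using measurable_sets_borel[OF measurable_inv_E, of "cball 0 (real i)"] by simp
  have "emeasure (haar E) (?A i) = emeasure lborel (cball (0::'a) (real i))" for i
    unfolding haar_def using sets by (subst emeasure_distr) (auto simp: vimage_def cball_def)
  moreover have "(\<Union>i. ?A i) = UNIV"
    by (auto simp: real_arch_simple)
  ultimately show "\<exists>A. countable A \<and> A \<subseteq> sets (haar E) \<and> \<Union> A = space (haar E) \<and> (\<forall>a\<in>A. emeasure (haar E) a \<noteq> \<infinity>)"
    using sets emeasure_bounded_finite[OF bounded_cball, of "0::'a"]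
    by (intro exI[of _ "range ?A"]) (auto simp: top.not_eq_extremum)
qed

lemma emeasure_haar_compact:
  assumes "compact K" "closed K"
  shows "emeasure (haar E) K < \<infinity>"
proof -
  have "inv E ` K = E -` K"
    by (force simp: image_iff)
  moreover have "emeasure (haar E) K = emeasure lborel (E -` K)"
    unfolding haar_def using assms by (subst emeasure_distr) auto
  moreover have "compact (inv E ` K)"
    by (intro compact_continuous_image assms continuous_on_subset[OF continuous_inv_E]) auto
  ultimately show ?thesis
    using emeasure_bounded_finite[OF compact_imp_bounded] by metis
qed

section \<open>Dilations measured in the Euclidean norm\<close>

definition coord_bound :: "real \<Rightarrow> real" where
  "coord_bound l = (if l \<le> 1 then l else l powr (\<Sum>j = 1..n. d j))"

lemma norm_\<Delta>_le: obtains C where "C > 0" "\<And>l p. l > 0 \<Longrightarrow> norm (\<Delta> l p) \<le> C * coord_bound l * norm p"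
proof -
  define r where "r j p = representation (X ` {1..n}) p (X j)" for j p
  have "linear (r j)" for j
    using linear_representation[OF basis_X(2,3)] unfolding r_def by (simp add: real_scaleR_def[abs_def] linear_def)
  then have bl: "bounded_linear (r j)" for j by (simp add: linear_conv_bounded_linear)
  have ex: "p = (\<Sum>j = 1..n. r j p *\<^sub>R X j)" for p
  proof -
    have "p = (\<Sum>v\<in>X ` {1..n}. representation (X ` {1..n}) p v *\<^sub>R v)"
      using basis_X(2,3) by (subst sum_representation_eq) auto
    also have "\<dots> = (\<Sum>j = 1..n. r j p *\<^sub>R X j)"
      unfolding sum.reindex[OF basis_X(1)] r_def by simp
    finally show ?thesis .
  qed
  \<comment> \<open>The sum collects the norms of the coordinate functionals times those of the
    eigenvectors; the summand 1 makes \<open>C\<close> positive.\<close>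
  define C where "C = (\<Sum>j = 1..n. onorm (r j) * norm (X j)) + 1"
  have on: "0 \<le> onorm (r j)" for j by (rule onorm_pos_le[OF bl])
  have "C > 0"
    unfolding C_def by (intro add_nonneg_pos sum_nonneg mult_nonneg_nonneg on) auto
  \<comment> \<open>For \<open>l \<le> 1\<close> every exponent is at least 1, so \<open>l\<close>
    itself is a bound; for \<open>l > 1\<close> every exponent is at most the sum of all of
    them.\<close>
  have pw: "l powr d j \<le> coord_bound l" if "l > 0" "j \<in> {1..n}" for l j
  proof (cases "l \<le> 1")
    case True
    then have "l powr d j \<le> l powr 1"
      using that d_ge_1[OF that(2)] by (intro powr_mono') auto
    then show ?thesis using True that by (simp add: coord_bound_def)
  next
    case False
    have "d j \<le> (\<Sum>j = 1..n. d j)"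
      using d_ge_1 that(2) by (intro member_le_sum) force+
    then show ?thesis using False by (simp add: coord_bound_def powr_mono)
  qed
  have "norm (\<Delta> l p) \<le> C * coord_bound l * norm p" if "l > 0" for l p
  proof -
    have cb: "coord_bound l \<ge> 0" using that by (simp add: coord_bound_def)
    have "norm (\<Delta> l p) = norm (\<Sum>j = 1..n. (l powr d j * r j p) *\<^sub>R X j)"
      by (subst ex[of p]) (simp only: \<Delta>_expansion[OF that])
    also have "\<dots> \<le> (\<Sum>j = 1..n. (l powr d j * \<bar>r j p\<bar>) * norm (X j))"
      by (rule order_trans[OF norm_sum]) (simp add: abs_mult)
    also have "\<dots> \<le> (\<Sum>j = 1..n. (coord_bound l * (onorm (r j) * norm p)) * norm (X j))"
      using onorm[OF bl, of _ p] pw[OF that] cb on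
      by (intro sum_mono mult_right_mono mult_mono) auto
    also have "\<dots> = (C - 1) * coord_bound l * norm p"
      by (simp add: C_def sum_distrib_left sum_distrib_right algebra_simps)
    also have "\<dots> \<le> C * coord_bound l * norm p"
      using cb by (intro mult_right_mono) auto
    finally show ?thesis .
  qed
  with \<open>C > 0\<close> show thesis by (rule that)
qed

lemma \<Delta>_\<Delta>:
  assumes "k > 0" "l > 0"
  shows "\<Delta> k (\<Delta> l p) = \<Delta> (k * l) p"
proof -
  obtain c where c: "p = (\<Sum>j = 1..n. c j *\<^sub>R X j)" by (rule basis_X_expansion)
  have "k * l > 0" using assms by simp
  show ?thesis
    unfolding c \<Delta>_expansion[OF assms(2)] \<Delta>_expansion[OF assms(1)] \<Delta>_expansion[OF \<open>k * l > 0\<close>]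
    using assms by (simp add: powr_mult mult.assoc)
qed

lemma \<Delta>_1: "\<Delta> 1 p = p"
proof -
  obtain c where c: "p = (\<Sum>j = 1..n. c j *\<^sub>R X j)" by (rule basis_X_expansion)
  show ?thesis unfolding c \<Delta>_expansion[OF zero_less_one] by simp
qed

lemma continuous_\<Delta>_path: "continuous_on {0<..} (\<lambda>l. \<Delta> l p)"
proof -
  obtain c where c: "p = (\<Sum>j = 1..n. c j *\<^sub>R X j)" by (rule basis_X_expansion)
  have "continuous_on {0<..} (\<lambda>l. \<Sum>j = 1..n. (l powr d j * c j) *\<^sub>R X j)"
    by (intro continuous_intros) auto
  then show ?thesis
    unfolding c by (rule continuous_on_eq) (simp only: \<Delta>_expansion greaterThan_iff)
qed

end

section \<open>Homogeneous norms: comparison with the Euclidean norm and volume of balls\<close>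

locale homogeneous_normed = homogeneous E \<Delta> n X d
  for E :: "'a::euclidean_space \<Rightarrow> 'g::topological_group_add" and \<Delta> n X d +
  fixes N :: "'g \<Rightarrow> real" and Q s :: real
  assumes norm: "homogeneous_norm E \<Delta> N"
    and Q: "Q = (\<Sum>j = 1..n. d j)" and s: "0 < s" "s < 1"
begin

lemma N_nonneg [simp]: "0 \<le> N g"
  and N_eq_0_iff [simp]: "N g = 0 \<longleftrightarrow> g = 0"
  and N_minus [simp]: "N (- g) = N g"
  and N_0 [simp]: "N 0 = 0"
  using norm by (auto simp: homogeneous_norm_def)

lemma N_\<Delta>: "l > 0 \<Longrightarrow> N (E (\<Delta> l p)) = l * N (E p)"
proof -
  assume "l > 0"
  then have "N (group_dilation E \<Delta> l (E p)) = l * N (E p)"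
    using norm by (simp add: homogeneous_norm_def)
  then show ?thesis by (simp add: group_dilation_def)
qed

lemma N_pos_iff: "0 < N (E p) \<longleftrightarrow> p \<noteq> 0"
  using N_nonneg[of "E p"] N_eq_0_iff[of "E p"] E_eq_iff[of p 0] by (metis E_0 less_eq_real_def less_irrefl)

lemma continuous_N: "continuous_on UNIV N"
  using norm by (simp add: homogeneous_norm_def)

lemma measurable_N [measurable]: "N \<in> borel_measurable borel"
  by (rule borel_measurable_continuous_onI[OF continuous_N])

lemma continuous_N_E: "continuous_on A (\<lambda>p. N (E p))"
  by (rule continuous_on_compose2[OF continuous_N continuous_on_subset[OF continuous_E]]) auto

lemma Q_ge_1: "1 \<le> Q"
proof -
  have "n \<noteq> 0"
  proof
    assume "n = 0"
    then have "(UNIV :: 'a set) = {0}" using basis_X(3) by simp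
    then show False using DIM_positive[where 'a = 'a] nonempty_Basis nonzero_Basis by blast
  qed
  then have "1 \<in> {1..n}" by simp
  have "d 1 \<le> (\<Sum>j = 1..n. d j)"
    using d_ge_1 by (intro member_le_sum[OF \<open>1 \<in> {1..n}\<close>]) force+
  then show ?thesis using d_ge_1[OF \<open>1 \<in> {1..n}\<close>] by (simp add: Q)
qed

text \<open>On the Euclidean unit sphere \<open>N\<close> has a positive minimum by compactness. A
  point with \<open>norm p > 1\<close> is shrunk by some \<open>l \<le> 1\<close> onto that sphere;
  homogeneity and \<open>N (E p) \<le> 1\<close> bound \<open>l\<close> from below, and dilating
  back by \<open>1 / l\<close> bounds \<open>norm p\<close>.\<close>

lemma bounded_N_le_1: obtains R where "R > 0" "\<And>p. N (E p) \<le> 1 \<Longrightarrow> norm p \<le> R"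
proof -
  obtain C where C: "C > 0" "\<And>l p. l > 0 \<Longrightarrow> norm (\<Delta> l p) \<le> C * coord_bound l * norm p"
    using norm_\<Delta>_le by blast
  have "sphere (0::'a) 1 \<noteq> {}" by simp
  then obtain p0 where p0: "p0 \<in> sphere 0 1" "\<And>p. p \<in> sphere 0 1 \<Longrightarrow> N (E p0) \<le> N (E p)"
    using continuous_attains_inf[OF compact_sphere _ continuous_N_E, of 0 1] by blast
  define c where "c = min 1 (N (E p0))"
  have "p0 \<noteq> 0" using p0(1) by auto
  then have c: "0 < c" "c \<le> 1" using N_pos_iff[of p0] by (auto simp: c_def)
  \<comment> \<open>The inner summand 1 covers \<open>coord_bound (1 / l)\<close> when
    \<open>1 / l \<le> 1\<close>, the outer one the points with
    \<open>norm p \<le> 1\<close>.\<close>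
  define R where "R = C * ((1 / c) powr Q + 1) + 1"
  have "R > 0" unfolding R_def using C(1) by (intro add_nonneg_pos mult_nonneg_nonneg) auto
  have R1: "1 \<le> R" unfolding R_def using C(1) by simp
  have "norm p \<le> R" if "N (E p) \<le> 1" for p
  proof (cases "norm p \<le> 1")
    case True
    then show ?thesis using R1 by simp
  next
    case False
    then have np: "norm p > 1" by simp
    then have "p \<noteq> 0" by auto
    \<comment> \<open>Chosen so that the estimate for dilations pushes \<open>\<Delta> l0 p\<close>
      inside the unit sphere; the intermediate value theorem on \<open>{l0..1}\<close> then finds
      the dilate of norm 1.\<close>
    define l0 where "l0 = min 1 (1 / (2 * C * norm p))"
    have l0: "0 < l0" "l0 \<le> 1" using C(1) \<open>p \<noteq> 0\<close> by (auto simp: l0_def intro!: mult_pos_pos)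
    have "norm (\<Delta> l0 p) \<le> C * l0 * norm p"
      using C(2)[OF l0(1), of p] l0 by (simp add: coord_bound_def)
    also have "\<dots> \<le> C * (1 / (2 * C * norm p)) * norm p"
      using C(1) by (intro mult_right_mono mult_left_mono) (auto simp: l0_def)
    also have "\<dots> < 1" using C(1) np by simp
    finally have "norm (\<Delta> l0 p) \<le> 1" by simp
    moreover have "1 \<le> norm (\<Delta> 1 p)" using np by (simp add: \<Delta>_1)
    moreover have "continuous_on {l0..1} (\<lambda>l. norm (\<Delta> l p))"
      using l0 by (intro continuous_intros continuous_on_subset[OF continuous_\<Delta>_path]) auto
    ultimately obtain l where l: "l0 \<le> l" "l \<le> 1" "norm (\<Delta> l p) = 1"
      using IVT'[of "\<lambda>l. norm (\<Delta> l p)" l0 1 1] l0(2) by blast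
    have "l > 0" using l l0 by simp
    have "N (E p0) \<le> N (E (\<Delta> l p))"
      using l(3) by (intro p0(2)) simp
    also have "\<dots> \<le> l * 1"
      unfolding N_\<Delta>[OF \<open>l > 0\<close>] using that \<open>l > 0\<close> by (intro mult_left_mono) auto
    finally have "c \<le> l" by (simp add: c_def)
    have "p = \<Delta> (1 / l) (\<Delta> l p)"
      using \<open>l > 0\<close> by (simp add: \<Delta>_\<Delta> \<Delta>_1)
    then have "norm p \<le> C * coord_bound (1 / l) * norm (\<Delta> l p)"
      using C(2)[of "1 / l" "\<Delta> l p"] \<open>l > 0\<close> by simp
    also have "\<dots> = C * coord_bound (1 / l)" by (simp add: l(3))
    also have "\<dots> \<le> C * ((1 / c) powr Q + 1)"
    proof (intro mult_left_mono)
      have "1 / l \<le> 1 / c" using \<open>c \<le> l\<close> c by (simp add: frac_le)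
      then have "(1 / l) powr Q \<le> (1 / c) powr Q"
        using \<open>l > 0\<close> Q_ge_1 by (intro powr_mono2) auto
      then show "coord_bound (1 / l) \<le> (1 / c) powr Q + 1"
        unfolding coord_bound_def Q[symmetric] by (auto intro: order_trans[OF _ le_add_same_cancel2[THEN iffD2]])
    qed (use C in simp)
    finally show ?thesis by (simp add: R_def)
  qed
  with \<open>R > 0\<close> show thesis by (rule that)
qed

text \<open>Dilating by \<open>1 / N (E p)\<close> moves \<open>p\<close> to the level
  \<open>N = 1\<close>, which is bounded. Dilating back costs at most a constant times
  \<open>N (E p)\<close>, because this factor is at most 1 and all weights are at least 1.\<close>

lemma norm_le_N: obtains C where "C > 0" "\<And>p. N (E p) \<le> 1 \<Longrightarrow> norm p \<le> C * N (E p)"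
proof -
  obtain C where C: "C > 0" "\<And>l p. l > 0 \<Longrightarrow> norm (\<Delta> l p) \<le> C * coord_bound l * norm p"
    using norm_\<Delta>_le by blast
  obtain R where R: "R > 0" "\<And>p. N (E p) \<le> 1 \<Longrightarrow> norm p \<le> R"
    using bounded_N_le_1 by blast
  show thesis
  proof (rule that[of "C * R"])
    show "norm p \<le> C * R * N (E p)" if "N (E p) \<le> 1" for p
    proof (cases "p = 0")
      case False
      define l where "l = N (E p)"
      have l: "0 < l" "l \<le> 1" using False that N_pos_iff by (auto simp: l_def)
      have q: "N (E (\<Delta> (1 / l) p)) = 1" using l by (simp add: N_\<Delta>) (simp add: l_def)
      have "p = \<Delta> l (\<Delta> (1 / l) p)" using l by (simp add: \<Delta>_\<Delta> \<Delta>_1)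
      then have "norm p \<le> C * coord_bound l * norm (\<Delta> (1 / l) p)"
        using C(2)[OF l(1), of "\<Delta> (1 / l) p"] by simp
      also have "\<dots> \<le> C * l * R"
        using l C(1) R(2)[of "\<Delta> (1 / l) p"] q by (intro mult_mono) (auto simp: coord_bound_def)
      finally show ?thesis by (simp add: l_def mult_ac)
    qed simp
  qed (use C R in simp)
qed

text \<open>The dilation by \<open>r\<close> maps the unit ball onto the ball of radius
  \<open>r\<close> and has Jacobian \<open>r powr Q\<close>.\<close>

lemma emeasure_N_less:
  assumes "r > 0"
  shows "emeasure (haar E) {g. N g < r} = ennreal (r powr Q) * emeasure (haar E) {g. N g < 1}"
proof -
  have sets: "{g. N g < r} \<in> sets borel" for r
    using measurable_sets_borel[OF measurable_N, of "{..<r}"] by (simp add: vimage_def)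
  have em: "emeasure (haar E) {g. N g < r} = emeasure lborel {p. N (E p) < r}" for r
    unfolding haar_def using sets by (subst emeasure_distr) (auto simp: vimage_def)
  have setsE: "{p. N (E p) < r} \<in> sets borel" for r
    using measurable_sets_borel[OF measurable_E sets[of r]] by (simp add: vimage_def)
  have inv: "\<Delta> r (\<Delta> (1 / r) p) = p" "\<Delta> (1 / r) (\<Delta> r p) = p" for p
    using assms by (simp_all add: \<Delta>_\<Delta> \<Delta>_1)
  have im: "\<Delta> r ` {p. N (E p) < 1} = {p. N (E p) < r}"
  proof (intro equalityI subsetI)
    fix p assume "p \<in> {p. N (E p) < r}"
    then have "N (E (\<Delta> (1 / r) p)) < 1" using assms by (simp add: N_\<Delta>)
    then show "p \<in> \<Delta> r ` {p. N (E p) < 1}" using inv(1)[of p] by (metis image_eqI mem_Collect_eq)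
  qed (use assms in \<open>auto simp: N_\<Delta>\<close>)
  obtain R where "\<And>p. N (E p) \<le> 1 \<Longrightarrow> norm p \<le> R"
    using bounded_N_le_1 by blast
  then have "bounded {p. N (E p) < 1}"
    by (intro boundedI) force
  then have fin: "emeasure lborel {p. N (E p) < 1} < \<infinity>"
    by (rule emeasure_bounded_finite)
  have "emeasure lborel (\<Delta> r ` {p. N (E p) < 1}) = ennreal (r powr Q) * emeasure lborel {p. N (E p) < 1}"
  proof (rule emeasure_image_edet[OF _ _ _ setsE fin])
    show "(\<Delta> r has_derivative \<Delta> r) (at x)" for x
      using linear_\<Delta>[OF assms] by (simp add: linear_conv_bounded_linear bounded_linear_imp_has_derivative)
    show "inj (\<Delta> r)" by (rule inj_on_inverseI[where g = "\<Delta> (1 / r)"]) (rule inv)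
    show "\<bar>edet (\<Delta> r)\<bar> = r powr Q" using edet_\<Delta>[OF assms] by (simp add: Q)
    show "\<Delta> r ` {p. N (E p) < 1} \<in> sets borel" unfolding im by (rule setsE)
  qed
  then show ?thesis by (simp add: em im)
qed

lemma emeasure_N_less_finite: "emeasure (haar E) {g. N g < 1} < \<infinity>"
proof -
  have "emeasure (haar E) {g. N g < 1} = emeasure lborel {p. N (E p) < 1}"
    unfolding haar_def using measurable_sets_borel[OF measurable_N, of "{..<1}"]
    by (subst emeasure_distr) (auto simp: vimage_def)
  moreover obtain R where "\<And>p. N (E p) \<le> 1 \<Longrightarrow> norm p \<le> R"
    using bounded_N_le_1 by blast
  then have "bounded {p. N (E p) < 1}"
    by (intro boundedI) force
  ultimately show ?thesis by (metis emeasure_bounded_finite)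
qed

end

subsection \<open>The fractional form and operator\<close>

context homogeneous_normed
begin

section \<open>Integrability of the truncated square against the kernel\<close>

abbreviation kern :: "'g \<Rightarrow> real" where
  "kern h \<equiv> 1 / N h powr (Q + 2 * s)"

lemma measurable_kern [measurable]: "(\<lambda>h. kern h) \<in> borel_measurable borel"
  by measurable

text \<open>The mass of the dyadic shell \<open>N h \<approx> 2\<^sup>i\<close> is comparable to \<open>2 powr (i Q)\<close>, so that the
  shells contribute geometric series with ratios \<open>2 powr (- 2 s)\<close> at infinity and
  \<open>2 powr (2 s - 2)\<close> at the identity.\<close>

lemma nn_integral_min_kern: "(\<integral>\<^sup>+h. ennreal ((min 1 (N h))\<^sup>2 * kern h) \<partial>haar E) < \<infinity>"
proof -
  define V where "V = emeasure (haar E) {g. N g < 1}"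
  have V: "V < \<infinity>" unfolding V_def by (rule emeasure_N_less_finite)
  define T where "T = Q + 2 * s"
  have T: "T > 0" using Q_ge_1 s by (simp add: T_def)
  \<comment> \<open>\<open>a i\<close> bounds the integrand on the shell from \<open>2^i\<close> to
    \<open>2^(i+1)\<close>, and \<open>b i\<close> on the shell from \<open>2^(-i-1)\<close> to
    \<open>2^(-i)\<close>; in the latter the factor \<open>2^(-2i)\<close> comes from the square of
    \<open>N\<close>. The shells are enlarged to the balls \<open>A i\<close> and
    \<open>B i\<close>, whose measures are known by scaling.\<close>
  define a where "a i = 2 powr (- real i * T)" for i :: nat
  define b where "b i = 2 powr ((real i + 1) * T - 2 * real i)" for i :: nat
  define A where "A i = {g. N g < 2 powr (real i + 1)}" for i :: nat
  \<comment> \<open>The inner shell contains its outer boundary \<open>N g = 2^(-i)\<close>, so the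
    open ball needs a larger radius.\<close>
  define B where "B i = {g. N g < 2 powr (1 - real i)}" for i :: nat
  have sets [measurable]: "A i \<in> sets borel" "B i \<in> sets borel" for i
    unfolding A_def B_def by measurable
  define f where "f i g = ennreal (a i) * indicator (A i) g + ennreal (b i) * indicator (B i) g" for i g
  have le: "ennreal ((min 1 (N g))\<^sup>2 * kern g) \<le> (\<Sum>i. f i g)" for g
  proof (cases "g = 0")
    case False
    then have pos: "N g > 0" using N_nonneg[of g] N_eq_0_iff[of g] by linarith
    have "\<exists>i. ennreal ((min 1 (N g))\<^sup>2 * kern g) \<le> f i g"
    proof (cases "1 \<le> N g")
      case True
      define i where "i = nat \<lfloor>log 2 (N g)\<rfloor>"
      have "0 \<le> log 2 (N g)" using True by simp
      then have i: "real i \<le> log 2 (N g)" "log 2 (N g) < real i + 1"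
        unfolding i_def by linarith+
      have g: "2 powr real i \<le> N g" "N g < 2 powr (real i + 1)"
        using i pos by (simp_all add: le_log_iff log_less_iff)
      have "(2 powr real i) powr T \<le> N g powr T"
        using g(1) T by (intro powr_mono2) auto
      then have "kern g \<le> 1 / (2 powr real i) powr T"
        unfolding T_def[symmetric] by (intro divide_left_mono) (use pos in \<open>auto intro!: mult_pos_pos\<close>)
      also have "\<dots> = a i"
        by (simp add: a_def powr_powr powr_minus_divide)
      finally have "(min 1 (N g))\<^sup>2 * kern g \<le> a i" using True by simp
      then show ?thesis
        using g(2) by (intro exI[of _ i]) (auto simp: f_def A_def indicator_def intro!: ennreal_leI add_increasing2)
    next
      case False
      define i where "i = nat \<lfloor>- log 2 (N g)\<rfloor>"
      have "log 2 (N g) \<le> 0" using False pos by simp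
      then have i: "log 2 (N g) \<le> - real i" "- real i - 1 < log 2 (N g)"
        unfolding i_def by linarith+
      have g: "N g \<le> 2 powr (- real i)" "2 powr (- real i - 1) < N g"
        using i pos by (simp_all add: log_le_iff less_log_iff)
      have "(2 powr (- real i - 1)) powr T \<le> N g powr T"
        using g(2) T by (intro powr_mono2) auto
      then have "kern g \<le> 1 / (2 powr (- real i - 1)) powr T"
        unfolding T_def[symmetric] by (intro divide_left_mono) (use pos in \<open>auto intro!: mult_pos_pos\<close>)
      also have "\<dots> = 2 powr ((real i + 1) * T)"
        by (simp add: powr_powr powr_minus_divide[symmetric]) (simp add: algebra_simps)
      finally have k: "kern g \<le> 2 powr ((real i + 1) * T)" .
      have "(min 1 (N g))\<^sup>2 \<le> (2 powr (- real i))\<^sup>2"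
        using g(1) pos by (intro power_mono) auto
      also have "\<dots> = 2 powr (- 2 * real i)"
        by (simp add: power2_eq_square powr_add[symmetric])
      finally have "(min 1 (N g))\<^sup>2 * kern g \<le> 2 powr (- 2 * real i) * 2 powr ((real i + 1) * T)"
        using k by (intro mult_mono) auto
      also have "\<dots> = b i" by (simp add: b_def powr_add[symmetric])
      finally have "(min 1 (N g))\<^sup>2 * kern g \<le> b i" .
      moreover have "N g < 2 powr (1 - real i)"
        using g(1) by (rule le_less_trans) simp
      ultimately show ?thesis
        by (intro exI[of _ i]) (auto simp: f_def B_def indicator_def intro!: ennreal_leI add_increasing)
    qed
    then obtain i where "ennreal ((min 1 (N g))\<^sup>2 * kern g) \<le> f i g" ..
    also have "\<dots> \<le> (\<Sum>i. f i g)"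
      using sum_le_suminf[OF summableI, of "{i}" "\<lambda>i. f i g"] by simp
    finally show ?thesis .
  \<comment> \<open>At the identity the integrand is 0 because \<open>N 0 = 0\<close>.\<close>
  qed simp
  have int: "(\<integral>\<^sup>+g. f i g \<partial>haar E) = ennreal (2 powr Q * (2 powr (- 2 * s)) ^ i + 2 powr (2 * Q + 2 * s) * (2 powr (2 * s - 2)) ^ i) * V" for i
  proof -
    have "(\<integral>\<^sup>+g. f i g \<partial>haar E) = ennreal (a i) * emeasure (haar E) (A i) + ennreal (b i) * emeasure (haar E) (B i)"
      unfolding f_def by (subst nn_integral_add) (auto simp: nn_integral_cmult_indicator)
    also have "emeasure (haar E) (A i) = ennreal ((2 powr (real i + 1)) powr Q) * V"
      unfolding A_def V_def by (rule emeasure_N_less) simp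
    also have "emeasure (haar E) (B i) = ennreal ((2 powr (1 - real i)) powr Q) * V"
      unfolding B_def V_def by (rule emeasure_N_less) simp
    also have "ennreal (a i) * (ennreal ((2 powr (real i + 1)) powr Q) * V) + ennreal (b i) * (ennreal ((2 powr (1 - real i)) powr Q) * V)
      = ennreal (a i * (2 powr (real i + 1)) powr Q + b i * (2 powr (1 - real i)) powr Q) * V"
      by (simp add: a_def b_def ennreal_mult ennreal_plus distrib_right mult.assoc)
    also have "a i * (2 powr (real i + 1)) powr Q = 2 powr Q * (2 powr (- 2 * s)) ^ i"
      unfolding a_def powr_powr powr_add[symmetric] powr_realpow[symmetric, OF powr_gt_zero[THEN iffD2, OF zero_neq_numeral[symmetric]]]
      by (simp add: T_def algebra_simps)
    also have "b i * (2 powr (1 - real i)) powr Q = 2 powr (2 * Q + 2 * s) * (2 powr (2 * s - 2)) ^ i"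
      unfolding b_def powr_powr powr_add[symmetric] powr_realpow[symmetric, OF powr_gt_zero[THEN iffD2, OF zero_neq_numeral[symmetric]]]
      by (simp add: T_def algebra_simps)
    finally show ?thesis .
  qed
  have "(\<integral>\<^sup>+h. ennreal ((min 1 (N h))\<^sup>2 * kern h) \<partial>haar E) \<le> (\<integral>\<^sup>+g. (\<Sum>i. f i g) \<partial>haar E)"
    by (intro nn_integral_mono le)
  also have "\<dots> = (\<Sum>i. \<integral>\<^sup>+g. f i g \<partial>haar E)"
    unfolding f_def by (rule nn_integral_suminf) measurable
  also have "\<dots> = (\<Sum>i. ennreal (2 powr Q * (2 powr (- 2 * s)) ^ i + 2 powr (2 * Q + 2 * s) * (2 powr (2 * s - 2)) ^ i)) * V"
    unfolding int by (rule ennreal_suminf_multc)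
  also have "\<dots> < \<infinity>"
  proof -
    have "(2::real) powr (- 2 * s) < 1" "(2::real) powr (2 * s - 2) < 1"
      using s by (auto intro!: powr_less_one)
    then have "summable (\<lambda>i. 2 powr Q * (2 powr (- 2 * s)) ^ i + 2 powr (2 * Q + 2 * s) * (2 powr (2 * s - 2)) ^ i)"
      by (intro summable_add summable_mult summable_geometric) auto
    then have "(\<Sum>i. ennreal (2 powr Q * (2 powr (- 2 * s)) ^ i + 2 powr (2 * Q + 2 * s) * (2 powr (2 * s - 2)) ^ i)) \<noteq> top"
      by (rule ennreal_suminf_neq_top) simp
    then show ?thesis using V by (simp add: ennreal_mult_less_top top.not_eq_extremum)
  qed
  finally show ?thesis .
qed

lemma integrable_min_kern: "integrable (haar E) (\<lambda>h. (min 1 (N h))\<^sup>2 * kern h)"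
  by (rule integrableI_nonneg) (use nn_integral_min_kern in auto)

lemma nn_integral_cmult_min_kern:
  assumes "c \<ge> 0"
  shows "(\<integral>\<^sup>+h. ennreal (c * ((min 1 (N h))\<^sup>2 * kern h)) \<partial>haar E) < \<infinity>"
proof -
  have "integrable (haar E) (\<lambda>h. c * ((min 1 (N h))\<^sup>2 * kern h))"
    by (intro integrable_mult_right integrable_min_kern)
  then show ?thesis
    using assms by (simp add: integrable_iff_bounded abs_mult)
qed

lemma integrable_kern_mult:
  assumes [measurable]: "f \<in> borel_measurable borel" and le: "\<And>h. \<bar>f h\<bar> \<le> C * (min 1 (N h))\<^sup>2"
  shows "integrable (haar E) (\<lambda>h. f h * kern h)"
proof (rule Bochner_Integration.integrable_bound)
  show "integrable (haar E) (\<lambda>h. C * ((min 1 (N h))\<^sup>2 * kern h))"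
    by (intro integrable_mult_right integrable_min_kern)
  show "AE h in haar E. norm (f h * kern h) \<le> norm (C * ((min 1 (N h))\<^sup>2 * kern h))"
  proof (intro AE_I2)
    fix h
    have "C * (min 1 (N h))\<^sup>2 \<le> \<bar>C\<bar> * (min 1 (N h))\<^sup>2"
      by (intro mult_right_mono) auto
    then have "\<bar>f h\<bar> * kern h \<le> \<bar>C\<bar> * (min 1 (N h))\<^sup>2 * kern h"
      by (intro mult_right_mono order_trans[OF le]) auto
    then show "norm (f h * kern h) \<le> norm (C * ((min 1 (N h))\<^sup>2 * kern h))"
      by (simp add: abs_mult mult.assoc)
  qed
qed measurable

section \<open>Test functions and bounds for their differences\<close>

lemma test_function_support:
  assumes u: "u \<in> test_functions E"
  obtains S where "compact S" "closed S" "\<And>g. u g \<noteq> 0 \<Longrightarrow> g \<in> S"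
proof (rule that)
  show "compact (closure {g. u g \<noteq> 0})" using u by (simp add: test_functions_def)
  show "g \<in> closure {g. u g \<noteq> 0}" if "u g \<noteq> 0" for g
    using that by (intro subsetD[OF closure_subset]) simp
qed simp

lemma test_function_C2: "u \<in> test_functions E \<Longrightarrow> C2 (\<lambda>p. u (E p))"
  using smooth_on_UNIV_C2[of "u \<circ> E"] by (simp add: test_functions_def o_def)

lemma test_function_continuous: "u \<in> test_functions E \<Longrightarrow> continuous_on UNIV u"
proof -
  assume "u \<in> test_functions E"
  then have "continuous_on UNIV (\<lambda>p. u (E p))"
    by (intro C1_continuous C2_imp_C1 test_function_C2)
  then have "continuous_on UNIV (\<lambda>g. u (E (inv E g)))"
    by (rule continuous_on_compose2[OF _ continuous_inv_E]) auto
  then show ?thesis by simp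
qed

lemma test_function_measurable: "u \<in> test_functions E \<Longrightarrow> u \<in> borel_measurable borel"
  by (rule borel_measurable_continuous_onI[OF test_function_continuous])

lemma test_function_bounded:
  assumes u: "u \<in> test_functions E"
  obtains C where "C > 0" "\<And>g. \<bar>u g\<bar> \<le> C"
proof -
  obtain S where S: "compact S" "closed S" "\<And>g. u g \<noteq> 0 \<Longrightarrow> g \<in> S"
    using test_function_support[OF u] by blast
  have "bounded (u ` S)"
    using S(1) continuous_on_subset[OF test_function_continuous[OF u]]
    by (intro compact_imp_bounded compact_continuous_image) auto
  then obtain C where C: "C > 0" "\<And>g. g \<in> S \<Longrightarrow> \<bar>u g\<bar> \<le> C"
    unfolding bounded_pos by auto
  have "\<bar>u g\<bar> \<le> C" for g using C S(3)[of g] by (cases "u g = 0") auto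
  with C(1) show thesis by (rule that)
qed

lemma test_function_integrable:
  assumes u: "u \<in> test_functions E"
  shows "integrable (haar E) u"
proof -
  obtain S where S: "compact S" "closed S" "\<And>g. u g \<noteq> 0 \<Longrightarrow> g \<in> S"
    using test_function_support[OF u] by blast
  obtain C where C: "C > 0" "\<And>g. \<bar>u g\<bar> \<le> C"
    using test_function_bounded[OF u] by blast
  have [measurable]: "S \<in> sets borel" using S by simp
  note [measurable] = test_function_measurable[OF u]
  show ?thesis
  proof (rule Bochner_Integration.integrable_bound)
    show "integrable (haar E) (\<lambda>g. C * indicator S g)"
      using emeasure_haar_compact[OF S(1,2)] by (intro integrable_mult_right integrable_real_indicator) auto
    show "AE g in haar E. norm (u g) \<le> norm (C * indicator S g)"
      using C S(3) by (intro AE_I2) (auto simp: indicator_def abs_mult)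
  qed measurable
qed

text \<open>If \<open>N h < 1\<close>, then \<open>g\<close> may be assumed to lie in a fixed compact set, as otherwise all
  terms vanish.\<close>

lemma test_function_difference_bounds:
  assumes u: "u \<in> test_functions E"
  obtains C where "C > 0"
    "\<And>g h. \<bar>u (g + h) - u g\<bar> \<le> C * min 1 (N h)"
    "\<And>g h. \<bar>2 * u g - u (g + h) - u (g - h)\<bar> \<le> C * (min 1 (N h))\<^sup>2"
proof -
  obtain S where S: "compact S" "closed S" "\<And>g. u g \<noteq> 0 \<Longrightarrow> g \<in> S"
    using test_function_support[OF u] by blast
  obtain C0 where C0: "C0 > 0" "\<And>g. \<bar>u g\<bar> \<le> C0"
    using test_function_bounded[OF u] by blast
  obtain R where R: "R > 0" "\<And>p. N (E p) \<le> 1 \<Longrightarrow> norm p \<le> R"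
    using bounded_N_le_1 by blast
  obtain C' where C': "C' > 0" "\<And>p. N (E p) \<le> 1 \<Longrightarrow> norm p \<le> C' * N (E p)"
    using norm_le_N by blast
  have "compact ((\<lambda>z. mul (fst z) (snd z)) ` (inv E ` S \<times> cball 0 R))"
    by (intro compact_continuous_image compact_Times S continuous_on_subset[OF continuous_mul]
        continuous_on_subset[OF continuous_inv_E] compact_cball) auto
  then have "bounded ((\<lambda>z. mul (fst z) (snd z)) ` (inv E ` S \<times> cball 0 R))"
    by (rule compact_imp_bounded)
  \<comment> \<open>Whichever of \<open>g\<close>, \<open>g + h\<close>, \<open>g - h\<close> lies
    in \<open>S\<close>, the coordinate \<open>q\<close> of \<open>g\<close> is a product of that
    point with an element of norm at most \<open>R\<close>, so it is bounded by
    \<open>R'\<close>.\<close>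
  then obtain R' where R': "\<And>g p. g \<in> S \<Longrightarrow> norm p \<le> R \<Longrightarrow> norm (mul (inv E g) p) \<le> R'"
    unfolding bounded_iff by force
  define K where "K = cball (0::'a) R' \<times> cball (0::'a) R"
  have K: "compact K" "convex K"
    unfolding K_def by (auto intro: compact_Times convex_Times)
  \<comment> \<open>Lifting \<open>u\<close> to pairs turns group increments into Euclidean ones:
    with \<open>q\<close> and \<open>p\<close> the coordinates of \<open>g\<close> and
    \<open>h\<close>, the points \<open>g + h\<close> and \<open>g - h\<close> correspond to
    \<open>(q, 0)\<close> shifted by \<open>(0, p)\<close> and by its negative.\<close>
  define G where "G z = u (E (mul (fst z) (snd z)))" for z
  have G: "C2 G"
    unfolding G_def by (rule C2_compose[OF test_function_C2[OF u] C2_mul])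
  obtain D1 where D1: "D1 \<ge> 0" "\<And>z v. z \<in> K \<Longrightarrow> z + v \<in> K \<Longrightarrow> \<bar>G (z + v) - G z\<bar> \<le> D1 * norm v"
    using C1_difference_bound[OF C2_imp_C1[OF G] K] by blast
  obtain D2 where D2: "D2 \<ge> 0" "\<And>z v. z + v \<in> K \<Longrightarrow> z - v \<in> K \<Longrightarrow> \<bar>2 * G z - G (z + v) - G (z - v)\<bar> \<le> D2 * norm v ^ 2"
    using C2_second_difference_bound[OF G K] by blast
  \<comment> \<open>The first term serves \<open>N h > 1\<close>, where boundedness of
    \<open>u\<close> suffices; the others serve the first and second differences for
    \<open>N h \<le> 1\<close>.\<close>
  define C where "C = 4 * C0 + D1 * C' + D2 * C'\<^sup>2"
  have C: "2 * C0 \<le> C" "4 * C0 \<le> C" "D1 * C' \<le> C" "D2 * C'\<^sup>2 \<le> C" "C > 0"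
    unfolding C_def using C0(1) D1(1) D2(1) C'(1) by (auto intro!: add_pos_nonneg add_nonneg_nonneg simp: add_increasing add_increasing2)
  have small: "\<bar>u (g + h) - u g\<bar> \<le> C * N h \<and> \<bar>2 * u g - u (g + h) - u (g - h)\<bar> \<le> C * (N h)\<^sup>2"
    if h: "N h \<le> 1" for g h
  proof (cases "g \<in> S \<or> g + h \<in> S \<or> g - h \<in> S")
    case False
    then have "u g = 0" "u (g + h) = 0" "u (g - h) = 0" using S(3) by blast+
    then show ?thesis using C(5) by simp
  next
    case True
    define p where "p = inv E h"
    define q where "q = inv E g"
    have np: "norm p \<le> R" "norm p \<le> C' * N h"
      using R(2)[of p] C'(2)[of p] h by (simp_all add: p_def)
    have "q \<in> cball 0 R'"
    proof -
      have 1: "q = mul (inv E g) 0" "q = mul (inv E (g + h)) (- p)" "q = mul (inv E (g - h)) p"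
        by (simp_all add: E_eq_iff[symmetric] p_def q_def)
      show ?thesis using True 1 R'[of g 0] R'[of "g + h" "- p"] R'[of "g - h" p] R(1) np(1) by auto
    qed
    then have inK: "(q, 0) \<in> K" "(q, 0) + (0, p) \<in> K" "(q, 0) - (0, p) \<in> K"
      using np(1) R(1) by (auto simp: K_def)
    have Gz: "G (q, 0) = u g" "G ((q, 0) + (0, p)) = u (g + h)" "G ((q, 0) - (0, p)) = u (g - h)"
      by (simp_all add: G_def p_def q_def)
    have np0: "norm (0 :: 'a, p) = norm p" by (simp add: norm_Pair)
    have "\<bar>u (g + h) - u g\<bar> \<le> D1 * norm p"
      using D1(2)[OF inK(1,2)] by (simp only: Gz np0)
    also have "\<dots> \<le> D1 * (C' * N h)" using np(2) D1(1) by (intro mult_left_mono)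
    also have "\<dots> \<le> C * N h" using C(3) by (simp add: mult.assoc[symmetric] mult_right_mono)
    finally have 1: "\<bar>u (g + h) - u g\<bar> \<le> C * N h" .
    have "\<bar>2 * u g - u (g + h) - u (g - h)\<bar> \<le> D2 * norm p ^ 2"
      using D2(2)[OF inK(2,3)] by (simp only: Gz np0)
    also have "\<dots> \<le> D2 * (C' * N h)\<^sup>2" using np(2) D2(1) by (intro mult_left_mono power_mono) auto
    also have "\<dots> \<le> C * (N h)\<^sup>2" using C(4) by (simp add: power_mult_distrib mult.assoc[symmetric] mult_right_mono)
    finally show ?thesis using 1 by blast
  qed
  show thesis
  proof (rule that[OF C(5)])
    fix g h
    have b: "\<bar>u g\<bar> \<le> C0" "\<bar>u (g + h)\<bar> \<le> C0" "\<bar>u (g - h)\<bar> \<le> C0" using C0(2) by blast+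
    show "\<bar>u (g + h) - u g\<bar> \<le> C * min 1 (N h)"
    proof (cases "N h \<le> 1")
      case False
      then have "C * min 1 (N h) = C" by simp
      then show ?thesis using b C(1) by linarith
    qed (use small in simp)
    show "\<bar>2 * u g - u (g + h) - u (g - h)\<bar> \<le> C * (min 1 (N h))\<^sup>2"
    proof (cases "N h \<le> 1")
      case False
      then have "C * (min 1 (N h))\<^sup>2 = C" by simp
      then show ?thesis using b C(2) by linarith
    qed (use small in simp)
  qed
qed

section \<open>Integrands and changes of variables\<close>

lemma frac_integrand_eq: "frac_integrand N Q s u g h = (2 * u g - u (g + h) - u (g - h)) * kern h"
  by (simp add: frac_integrand_def)

lemma dirichlet_integrand_eq:
  "dirichlet_integrand N Q s u \<phi> g h = (u g - u h) * (\<phi> g - \<phi> h) * kern (- h + g)"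
  by (simp add: dirichlet_integrand_def)

lemma integrable_frac_integrand:
  assumes u: "u \<in> test_functions E"
  shows "integrable (haar E) (frac_integrand N Q s u g)"
proof -
  note [measurable] = test_function_measurable[OF u]
  obtain C where "\<And>g h. \<bar>2 * u g - u (g + h) - u (g - h)\<bar> \<le> C * (min 1 (N h))\<^sup>2"
    by (rule test_function_difference_bounds[OF u]) blast
  then show ?thesis
    unfolding frac_integrand_eq[abs_def] by (intro integrable_kern_mult) measurable
qed

lemma integral_haar_left:
  fixes f :: "'g \<Rightarrow> real"
  assumes "f \<in> borel_measurable borel"
  shows "(\<integral>h. f (g + h) \<partial>haar E) = (\<integral>h. f h \<partial>haar E)"
  using integral_distr[of "\<lambda>h. g + h" "haar E" borel f] assms by (simp add: distr_haar_left)

lemma integral_haar_right: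
  fixes f :: "'g \<Rightarrow> real"
  assumes "f \<in> borel_measurable borel"
  shows "(\<integral>h. f (h + g) \<partial>haar E) = (\<integral>h. f h \<partial>haar E)"
  using integral_distr[of "\<lambda>h. h + g" "haar E" borel f] assms by (simp add: distr_haar_right)

lemma integral_haar_uminus:
  fixes f :: "'g \<Rightarrow> real"
  assumes "f \<in> borel_measurable borel"
  shows "(\<integral>h. f (- h) \<partial>haar E) = (\<integral>h. f h \<partial>haar E)"
  using integral_distr[of uminus "haar E" borel f] assms measurable_group_uminus[of "\<lambda>x. x" borel]
  by (simp add: distr_haar_uminus)

lemma integrable_haar_left:
  fixes f :: "'g \<Rightarrow> real"
  assumes "integrable (haar E) f"
  shows "integrable (haar E) (\<lambda>h. f (g + h))"
  using integrable_distr[of "\<lambda>h. g + h" "haar E" borel f] assms by (simp add: distr_haar_left)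

lemma integrable_haar_right:
  fixes f :: "'g \<Rightarrow> real"
  assumes "integrable (haar E) f"
  shows "integrable (haar E) (\<lambda>h. f (h + g))"
  using integrable_distr[of "\<lambda>h. h + g" "haar E" borel f] assms by (simp add: distr_haar_right)

lemma integrable_haar_uminus:
  fixes f :: "'g \<Rightarrow> real"
  assumes "integrable (haar E) f"
  shows "integrable (haar E) (\<lambda>h. f (- h))"
  using integrable_distr[of uminus "haar E" borel f] assms measurable_group_uminus[of "\<lambda>x. x" borel]
  by (simp add: distr_haar_uminus)

lemma nn_integral_haar_left:
  assumes "f \<in> borel_measurable borel"
  shows "(\<integral>\<^sup>+h. f (g + h) \<partial>haar E) = (\<integral>\<^sup>+h. f h \<partial>haar E)"
  using nn_integral_distr[of "\<lambda>h. g + h" "haar E" borel f] assms by (simp add: distr_haar_left)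

lemma nn_integral_haar_right:
  assumes "f \<in> borel_measurable borel"
  shows "(\<integral>\<^sup>+h. f (h + g) \<partial>haar E) = (\<integral>\<^sup>+h. f h \<partial>haar E)"
  using nn_integral_distr[of "\<lambda>h. h + g" "haar E" borel f] assms by (simp add: distr_haar_right)

section \<open>The form as an absolutely convergent double integral\<close>

lemma pair_sigma_finite_haar: "pair_sigma_finite (haar E) (haar E)"
  using sigma_finite_haar by (simp add: pair_sigma_finite_def)

text \<open>The substitution \<open>g = h k\<close> makes the kernel a function of \<open>k\<close>
  alone, so that the integration over \<open>h\<close> sees only \<open>u\<close> and
  \<open>\<phi>\<close>.\<close>

definition shifted_integrand :: "('g \<Rightarrow> real) \<Rightarrow> ('g \<Rightarrow> real) \<Rightarrow> 'g \<Rightarrow> 'g \<Rightarrow> real" where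
  "shifted_integrand u \<phi> h k = (u (h + k) - u h) * (\<phi> (h + k) - \<phi> h) * kern k"

lemma dirichlet_integrand_shift:
  "dirichlet_integrand N Q s u \<phi> (h + k) h = shifted_integrand u \<phi> h k"
  by (simp add: dirichlet_integrand_eq shifted_integrand_def add.assoc[symmetric])

text \<open>Two first differences together give the square of \<open>min 1 (N k)\<close>, which
  tames the kernel. The factor from \<open>u\<close> vanishes unless \<open>h\<close> or
  \<open>h + k\<close> lies in the compact set \<open>S\<close>, and by right invariance each
  alternative contributes the measure of \<open>S\<close>, uniformly in \<open>k\<close>.\<close>

lemma integrable_shifted_integrand:
  assumes u: "u \<in> test_functions E" and \<phi>: "\<phi> \<in> test_functions E"
  shows "integrable (haar E \<Otimes>\<^sub>M haar E) (\<lambda>(h, k). shifted_integrand u \<phi> h k)"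
proof (rule integrableI_bounded)
  interpret pair_sigma_finite "haar E" "haar E" by (rule pair_sigma_finite_haar)
  note [measurable] = test_function_measurable[OF u] test_function_measurable[OF \<phi>]
  show meas: "(\<lambda>(h, k). shifted_integrand u \<phi> h k) \<in> borel_measurable (haar E \<Otimes>\<^sub>M haar E)"
    unfolding shifted_integrand_def by measurable
  obtain S where S: "compact S" "closed S" "\<And>g. u g \<noteq> 0 \<Longrightarrow> g \<in> S"
    using test_function_support[OF u] by blast
  have [measurable]: "S \<in> sets borel" using S by simp
  obtain A where A: "A > 0" "\<And>g h. \<bar>u (g + h) - u g\<bar> \<le> A * min 1 (N h)"
    by (rule test_function_difference_bounds[OF u]) blast
  obtain B where B: "B > 0" "\<And>g h. \<bar>\<phi> (g + h) - \<phi> g\<bar> \<le> B * min 1 (N h)"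
    by (rule test_function_difference_bounds[OF \<phi>]) blast
  let ?w = "\<lambda>k. ennreal (A * B * ((min 1 (N k))\<^sup>2 * kern k))"
  have le: "ennreal (norm (shifted_integrand u \<phi> h k)) \<le> ?w k * (indicator S (h + k) + indicator S h)" for h k
  proof (cases "h \<in> S \<or> h + k \<in> S")
    case False
    then have "u h = 0" "u (h + k) = 0" using S(3) by blast+
    then show ?thesis by (simp add: shifted_integrand_def)
  next
    case True
    have "\<bar>u (h + k) - u h\<bar> * \<bar>\<phi> (h + k) - \<phi> h\<bar> \<le> (A * min 1 (N k)) * (B * min 1 (N k))"
      using A B by (intro mult_mono) auto
    then have "\<bar>u (h + k) - u h\<bar> * \<bar>\<phi> (h + k) - \<phi> h\<bar> * kern k \<le> (A * min 1 (N k)) * (B * min 1 (N k)) * kern k"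
      by (rule mult_right_mono) simp
    then have "norm (shifted_integrand u \<phi> h k) \<le> A * B * ((min 1 (N k))\<^sup>2 * kern k)"
      by (simp add: shifted_integrand_def abs_mult power2_eq_square mult_ac)
    then have "ennreal (norm (shifted_integrand u \<phi> h k)) \<le> ?w k * 1"
      by (simp add: ennreal_leI)
    also have "\<dots> \<le> ?w k * (indicator S (h + k) + indicator S h)"
      using True by (intro mult_left_mono) (auto simp: indicator_def)
    finally show ?thesis .
  qed
  have "(\<integral>\<^sup>+z. ennreal (norm ((\<lambda>(h, k). shifted_integrand u \<phi> h k) z)) \<partial>(haar E \<Otimes>\<^sub>M haar E))
      = (\<integral>\<^sup>+k. \<integral>\<^sup>+h. ennreal (norm (shifted_integrand u \<phi> h k)) \<partial>haar E \<partial>haar E)"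
    using meas by (subst nn_integral_snd[symmetric]) auto
  also have "\<dots> \<le> (\<integral>\<^sup>+k. \<integral>\<^sup>+h. ?w k * (indicator S (h + k) + indicator S h) \<partial>haar E \<partial>haar E)"
    by (intro nn_integral_mono le)
  also have "\<dots> = (\<integral>\<^sup>+k. ?w k * (2 * emeasure (haar E) S) \<partial>haar E)"
  proof (intro nn_integral_cong)
    fix k
    have "(\<integral>\<^sup>+h. indicator S (h + k) + indicator S h \<partial>haar E) = 2 * emeasure (haar E) S"
      by (subst nn_integral_add) (auto simp: nn_integral_haar_right mult_2)
    then show "(\<integral>\<^sup>+h. ?w k * (indicator S (h + k) + indicator S h) \<partial>haar E) = ?w k * (2 * emeasure (haar E) S)"
      by (subst nn_integral_cmult) auto
  qed
  also have "\<dots> = (\<integral>\<^sup>+k. ?w k \<partial>haar E) * (2 * emeasure (haar E) S)"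
    by (rule nn_integral_multc) measurable
  also have "\<dots> < \<infinity>"
    using nn_integral_cmult_min_kern[of "A * B"] A(1) B(1) emeasure_haar_compact[OF S(1,2)]
    by (simp add: ennreal_mult_less_top)
  finally show "(\<integral>\<^sup>+z. ennreal (norm ((\<lambda>(h, k). shifted_integrand u \<phi> h k) z)) \<partial>(haar E \<Otimes>\<^sub>M haar E)) < \<infinity>" .
qed

text \<open>For each fixed \<open>h\<close>, left invariance in \<open>g\<close> turns the integral
  of the absolute value into that of the shifted integrand.\<close>

lemma integrable_dirichlet_integrand:
  assumes u: "u \<in> test_functions E" and \<phi>: "\<phi> \<in> test_functions E"
  shows "integrable (haar E \<Otimes>\<^sub>M haar E) (\<lambda>(g, h). dirichlet_integrand N Q s u \<phi> g h)"
proof (rule integrableI_bounded)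
  interpret pair_sigma_finite "haar E" "haar E" by (rule pair_sigma_finite_haar)
  note [measurable] = test_function_measurable[OF u] test_function_measurable[OF \<phi>]
  show meas: "(\<lambda>(g, h). dirichlet_integrand N Q s u \<phi> g h) \<in> borel_measurable (haar E \<Otimes>\<^sub>M haar E)"
    unfolding dirichlet_integrand_eq by measurable
  have meas1: "(\<lambda>g. ennreal (norm (dirichlet_integrand N Q s u \<phi> g h))) \<in> borel_measurable borel" for h
    unfolding dirichlet_integrand_eq by measurable
  note int = integrable_shifted_integrand[OF u \<phi>]
  have "(\<integral>\<^sup>+z. ennreal (norm ((\<lambda>(g, h). dirichlet_integrand N Q s u \<phi> g h) z)) \<partial>(haar E \<Otimes>\<^sub>M haar E))
      = (\<integral>\<^sup>+h. \<integral>\<^sup>+g. ennreal (norm (dirichlet_integrand N Q s u \<phi> g h)) \<partial>haar E \<partial>haar E)"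
    using meas by (subst nn_integral_snd[symmetric]) auto
  also have "\<dots> = (\<integral>\<^sup>+h. \<integral>\<^sup>+k. ennreal (norm (shifted_integrand u \<phi> h k)) \<partial>haar E \<partial>haar E)"
    by (simp only: dirichlet_integrand_shift[symmetric] nn_integral_haar_left[OF meas1])
  also have "\<dots> = (\<integral>\<^sup>+z. ennreal (norm ((\<lambda>(h, k). shifted_integrand u \<phi> h k) z)) \<partial>(haar E \<Otimes>\<^sub>M haar E))"
    using int[THEN borel_measurable_integrable] by (subst sigma_finite_measure.nn_integral_fst[OF sigma_finite_haar, symmetric]) auto
  also have "\<dots> < \<infinity>"
    using int by (simp add: integrable_iff_bounded)
  finally show "(\<integral>\<^sup>+z. ennreal (norm ((\<lambda>(g, h). dirichlet_integrand N Q s u \<phi> g h) z)) \<partial>(haar E \<Otimes>\<^sub>M haar E)) < \<infinity>" .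
qed

lemma dirichlet_form_eq_pair_integral:
  assumes "integrable (haar E \<Otimes>\<^sub>M haar E) (\<lambda>(g, h). dirichlet_integrand N Q s u \<phi> g h)"
  shows "dirichlet_form E N Q s u \<phi> = integral\<^sup>L (haar E \<Otimes>\<^sub>M haar E) (\<lambda>(g, h). dirichlet_integrand N Q s u \<phi> g h)"
proof -
  interpret pair_sigma_finite "haar E" "haar E" by (rule pair_sigma_finite_haar)
  show ?thesis
    unfolding dirichlet_form_def by (rule integral_snd[OF assms])
qed

lemma dirichlet_form_sym: "dirichlet_form E N Q s u \<phi> = dirichlet_form E N Q s \<phi> u"
  by (simp add: dirichlet_form_def dirichlet_integrand_def mult.commute)

text \<open>Additivity is read off the integral over the product, where both terms are integrable;
  in the iterated integral, Fubini provides inner integrability only for almost every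
  \<open>h\<close>.\<close>

lemma dirichlet_form_linear:
  assumes u: "u \<in> test_functions E" and v: "v \<in> test_functions E" and \<phi>: "\<phi> \<in> test_functions E"
  shows "dirichlet_form E N Q s (\<lambda>g. a * u g + b * v g) \<phi> =
    a * dirichlet_form E N Q s u \<phi> + b * dirichlet_form E N Q s v \<phi>"
proof -
  note i1 = integrable_dirichlet_integrand[OF u \<phi>] and i2 = integrable_dirichlet_integrand[OF v \<phi>]
  let ?D = "dirichlet_integrand N Q s"
  have eq: "(\<lambda>(g, h). ?D (\<lambda>g. a * u g + b * v g) \<phi> g h) =
     (\<lambda>z. a * (\<lambda>(g, h). ?D u \<phi> g h) z + b * (\<lambda>(g, h). ?D v \<phi> g h) z)"
    by (auto simp: dirichlet_integrand_eq algebra_simps add_divide_distrib diff_divide_distrib)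
  have "integrable (haar E \<Otimes>\<^sub>M haar E) (\<lambda>(g, h). ?D (\<lambda>g. a * u g + b * v g) \<phi> g h)"
    unfolding eq by (intro Bochner_Integration.integrable_add integrable_mult_right i1 i2)
  then have "dirichlet_form E N Q s (\<lambda>g. a * u g + b * v g) \<phi> =
      integral\<^sup>L (haar E \<Otimes>\<^sub>M haar E) (\<lambda>(g, h). ?D (\<lambda>g. a * u g + b * v g) \<phi> g h)"
    by (rule dirichlet_form_eq_pair_integral)
  also have "\<dots> = a * integral\<^sup>L (haar E \<Otimes>\<^sub>M haar E) (\<lambda>(g, h). ?D u \<phi> g h) +
      b * integral\<^sup>L (haar E \<Otimes>\<^sub>M haar E) (\<lambda>(g, h). ?D v \<phi> g h)"
    unfolding eq using i1 i2 by simp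
  finally show ?thesis
    by (simp add: dirichlet_form_eq_pair_integral i1 i2)
qed

section \<open>Expressing the form through the operator\<close>

lemma integrable_test_function_frac_integrand:
  assumes u: "u \<in> test_functions E" and \<phi>: "\<phi> \<in> test_functions E"
  shows "integrable (haar E \<Otimes>\<^sub>M haar E) (\<lambda>(h, k). \<phi> h * frac_integrand N Q s u h k)"
proof (rule integrableI_bounded)
  interpret pair_sigma_finite "haar E" "haar E" by (rule pair_sigma_finite_haar)
  note [measurable] = test_function_measurable[OF u] test_function_measurable[OF \<phi>]
  show meas: "(\<lambda>(h, k). \<phi> h * frac_integrand N Q s u h k) \<in> borel_measurable (haar E \<Otimes>\<^sub>M haar E)"
    unfolding frac_integrand_eq by measurable
  obtain C where C: "C > 0" "\<And>g h. \<bar>2 * u g - u (g + h) - u (g - h)\<bar> \<le> C * (min 1 (N h))\<^sup>2"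
    by (rule test_function_difference_bounds[OF u]) blast
  let ?w = "\<lambda>k. ennreal (C * ((min 1 (N k))\<^sup>2 * kern k))"
  \<comment> \<open>The second difference bound is uniform in \<open>h\<close>, so integrability in
    \<open>h\<close> comes from \<open>\<phi>\<close> and the double integral is dominated by a
    product of two finite integrals.\<close>
  have le: "ennreal (norm (\<phi> h * frac_integrand N Q s u h k)) \<le> ennreal (norm (\<phi> h)) * ?w k" for h k
  proof -
    have "\<bar>2 * u h - u (h + k) - u (h - k)\<bar> * kern k \<le> C * (min 1 (N k))\<^sup>2 * kern k"
      by (intro mult_right_mono C) auto
    then have "\<bar>\<phi> h\<bar> * (\<bar>2 * u h - u (h + k) - u (h - k)\<bar> * kern k) \<le> \<bar>\<phi> h\<bar> * (C * (min 1 (N k))\<^sup>2 * kern k)"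
      by (rule mult_left_mono) simp
    then have "norm (\<phi> h * frac_integrand N Q s u h k) \<le> norm (\<phi> h) * (C * ((min 1 (N k))\<^sup>2 * kern k))"
      by (simp add: frac_integrand_eq abs_mult mult.assoc)
    then show ?thesis by (subst ennreal_mult'[symmetric]) (auto intro: ennreal_leI)
  qed
  have "(\<integral>\<^sup>+z. ennreal (norm ((\<lambda>(h, k). \<phi> h * frac_integrand N Q s u h k) z)) \<partial>(haar E \<Otimes>\<^sub>M haar E))
      = (\<integral>\<^sup>+h. \<integral>\<^sup>+k. ennreal (norm (\<phi> h * frac_integrand N Q s u h k)) \<partial>haar E \<partial>haar E)"
    using meas by (subst sigma_finite_measure.nn_integral_fst[OF sigma_finite_haar, symmetric]) auto
  also have "\<dots> \<le> (\<integral>\<^sup>+h. \<integral>\<^sup>+k. ennreal (norm (\<phi> h)) * ?w k \<partial>haar E \<partial>haar E)"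
    by (intro nn_integral_mono le)
  also have "\<dots> = (\<integral>\<^sup>+h. ennreal (norm (\<phi> h)) \<partial>haar E) * (\<integral>\<^sup>+k. ?w k \<partial>haar E)"
    by (simp add: nn_integral_cmult nn_integral_multc)
  also have "\<dots> < \<infinity>"
    using test_function_integrable[OF \<phi>] nn_integral_cmult_min_kern[of C] C(1)
    by (simp add: ennreal_mult_less_top integrable_iff_bounded)
  finally show "(\<integral>\<^sup>+z. ennreal (norm ((\<lambda>(h, k). \<phi> h * frac_integrand N Q s u h k) z)) \<partial>(haar E \<Otimes>\<^sub>M haar E)) < \<infinity>" .
qed

text \<open>The kernel is constant in \<open>h\<close>. The product is split into a term with
  \<open>\<phi> (h + k)\<close> and one with \<open>\<phi> h\<close>; right translation by
  \<open>- k\<close> moves the first back to \<open>\<phi> h\<close>, and the sum is the second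
  difference. The split is made for fixed \<open>k\<close>, where both halves are integrable since
  \<open>\<phi>\<close> is integrable and \<open>u\<close> bounded.\<close>

lemma integral_shifted_integrand:
  assumes u: "u \<in> test_functions E" and \<phi>: "\<phi> \<in> test_functions E"
  shows "(\<integral>h. shifted_integrand u \<phi> h k \<partial>haar E) = (\<integral>h. \<phi> h * frac_integrand N Q s u h k \<partial>haar E)"
proof -
  note [measurable] = test_function_measurable[OF u] test_function_measurable[OF \<phi>]
  obtain C where C: "C > 0" "\<And>g. \<bar>u g\<bar> \<le> C"
    using test_function_bounded[OF u] by blast
  have i: "integrable (haar E) (\<lambda>h. \<phi> h * (u h - u (h + k)))" for k
  proof (rule Bochner_Integration.integrable_bound)
    show "integrable (haar E) (\<lambda>h. 2 * C * \<phi> h)"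
      using test_function_integrable[OF \<phi>] by simp
    have "\<bar>u h - u (h + k)\<bar> \<le> 2 * C" for h using C(2)[of h] C(2)[of "h + k"] by linarith
    then show "AE h in haar E. norm (\<phi> h * (u h - u (h + k))) \<le> norm (2 * C * \<phi> h)"
      using C(1) by (intro AE_I2) (simp add: abs_mult mult.commute[of "\<bar>\<phi> _\<bar>"] mult_right_mono)
  qed measurable
  have i': "integrable (haar E) (\<lambda>h. \<phi> (h + k) * (u (h + k) - u h))"
    using integrable_haar_right[OF i[of "- k"], of k] by (simp add: add.assoc)
  have "(\<integral>h. (u (h + k) - u h) * (\<phi> (h + k) - \<phi> h) \<partial>haar E) =
      (\<integral>h. \<phi> (h + k) * (u (h + k) - u h) + \<phi> h * (u h - u (h + k)) \<partial>haar E)"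
    by (simp add: algebra_simps)
  also have "\<dots> = (\<integral>h. \<phi> (h + k) * (u (h + k) - u h) \<partial>haar E) + (\<integral>h. \<phi> h * (u h - u (h + k)) \<partial>haar E)"
    using i i' by simp
  also have "(\<integral>h. \<phi> (h + k) * (u (h + k) - u h) \<partial>haar E) = (\<integral>h. \<phi> h * (u h - u (h + - k)) \<partial>haar E)"
    using integral_haar_right[of "\<lambda>h. \<phi> h * (u h - u (h + - k))" k] by (simp add: add.assoc)
  also have "(\<integral>h. \<phi> h * (u h - u (h + - k)) \<partial>haar E) + (\<integral>h. \<phi> h * (u h - u (h + k)) \<partial>haar E) =
     (\<integral>h. \<phi> h * (u h - u (h + - k)) + \<phi> h * (u h - u (h + k)) \<partial>haar E)"
    using i[of "- k"] i[of k] by (rule Bochner_Integration.integral_add[symmetric])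
  also have "\<dots> = (\<integral>h. \<phi> h * (2 * u h - u (h + k) - u (h - k)) \<partial>haar E)"
    by (simp add: algebra_simps)
  finally show ?thesis
    by (simp only: shifted_integrand_def frac_integrand_eq mult.assoc[symmetric] integral_mult_left_zero)
qed

text \<open>Fubini is used twice: once for the product of first differences, to bring the
  \<open>h\<close> integral inside, and once after the rearrangement, with the second difference as
  integrand, to bring it back outside. Each exchange has its own integrability lemma.\<close>

lemma dirichlet_form_eq_frac_operator:
  assumes u: "u \<in> test_functions E" and \<phi>: "\<phi> \<in> test_functions E"
  shows "integrable (haar E) (\<lambda>g. \<phi> g * frac_operator E N Q s u g)"
    and "dirichlet_form E N Q s u \<phi> = (\<integral>g. \<phi> g * frac_operator E N Q s u g \<partial>haar E)"
proof -
  interpret pair_sigma_finite "haar E" "haar E" by (rule pair_sigma_finite_haar)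
  note [measurable] = test_function_measurable[OF u] test_function_measurable[OF \<phi>]
  note int = integrable_test_function_frac_integrand[OF u \<phi>]
  show "integrable (haar E) (\<lambda>g. \<phi> g * frac_operator E N Q s u g)"
    using integrable_fst[OF int] by (simp add: frac_operator_def)
  have meas1: "(\<lambda>g. dirichlet_integrand N Q s u \<phi> g h) \<in> borel_measurable borel" for h
    unfolding dirichlet_integrand_eq by measurable
  have "dirichlet_form E N Q s u \<phi> = (\<integral>h. (\<integral>k. shifted_integrand u \<phi> h k \<partial>haar E) \<partial>haar E)"
    unfolding dirichlet_form_def dirichlet_integrand_shift[symmetric]
    by (simp only: integral_haar_left[OF meas1])
  also have "\<dots> = (\<integral>k. (\<integral>h. shifted_integrand u \<phi> h k \<partial>haar E) \<partial>haar E)"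
    using Fubini_integral[OF integrable_shifted_integrand[OF u \<phi>]] by simp
  also have "\<dots> = (\<integral>k. (\<integral>h. \<phi> h * frac_integrand N Q s u h k \<partial>haar E) \<partial>haar E)"
    by (simp only: integral_shifted_integrand[OF u \<phi>])
  also have "\<dots> = (\<integral>h. (\<integral>k. \<phi> h * frac_integrand N Q s u h k \<partial>haar E) \<partial>haar E)"
    by (rule Fubini_integral[OF int])
  finally show "dirichlet_form E N Q s u \<phi> = (\<integral>g. \<phi> g * frac_operator E N Q s u g \<partial>haar E)"
    by (simp add: frac_operator_def)
qed

section \<open>Truncated integrals and the principal value\<close>

lemma truncated_integral:
  assumes u: "u \<in> test_functions E" and \<epsilon>: "\<epsilon> > 0"
  shows "set_integrable (haar E) (- norm_ball N g \<epsilon>) (\<lambda>h. (u g - u h) / N (- h + g) powr (Q + 2 * s))"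
    and "2 * (LINT h : - norm_ball N g \<epsilon> | haar E. (u g - u h) / N (- h + g) powr (Q + 2 * s)) =
      (\<integral>h. indicator {h. \<epsilon> \<le> N h} h * frac_integrand N Q s u g h \<partial>haar E)"
proof -
  note [measurable] = test_function_measurable[OF u]
  obtain C where C: "C > 0" "\<And>g. \<bar>u g\<bar> \<le> C"
    using test_function_bounded[OF u] by blast
  \<comment> \<open>The truncated integrand translated to the identity. Its integral is unchanged
    under inversion, so twice that integral is the integral of \<open>P h + P (- h)\<close>, in
    which the second difference appears.\<close>
  define P where "P h = indicator {h. \<epsilon> \<le> N h} h * (u g - u (g + h)) * kern h" for h
  have [measurable]: "P \<in> borel_measurable borel"
    unfolding P_def[abs_def] by measurable
  have intP: "integrable (haar E) P"
    unfolding P_def[abs_def]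
  proof (rule integrable_kern_mult)
    \<comment> \<open>Outside the ball \<open>min 1 (N h)\<close> is at least
      \<open>min 1 \<epsilon>\<close>, so the crude bound \<open>2 * C\<close> can be rewritten as a
      multiple of the integrable weight.\<close>
    show "\<bar>indicator {h. \<epsilon> \<le> N h} h * (u g - u (g + h))\<bar> \<le> (2 * C / (min 1 \<epsilon>)\<^sup>2) * (min 1 (N h))\<^sup>2" for h
    proof (cases "\<epsilon> \<le> N h")
      case True
      have "\<bar>u g - u (g + h)\<bar> \<le> 2 * C" using C(2)[of g] C(2)[of "g + h"] by linarith
      also have "\<dots> = (2 * C / (min 1 \<epsilon>)\<^sup>2) * (min 1 \<epsilon>)\<^sup>2" using \<epsilon> by simp
      also have "\<dots> \<le> (2 * C / (min 1 \<epsilon>)\<^sup>2) * (min 1 (N h))\<^sup>2"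
        using True \<epsilon> C(1) by (intro mult_left_mono power_mono) auto
      finally show ?thesis using True by simp
    qed (use C(1) in simp)
  qed measurable
  have ind: "indicator (- norm_ball N g \<epsilon>) h *\<^sub>R ((u g - u h) / N (- h + g) powr (Q + 2 * s)) = P (- g + h)" for h
  proof -
    have "N (- h + g) = N (- g + h)"
      using N_minus[of "- h + g"] by (simp add: minus_add)
    then show ?thesis
      by (auto simp: P_def norm_ball_def indicator_def add.assoc[symmetric])
  qed
  show "set_integrable (haar E) (- norm_ball N g \<epsilon>) (\<lambda>h. (u g - u h) / N (- h + g) powr (Q + 2 * s))"
    unfolding set_integrable_def ind by (rule integrable_haar_left[OF intP])
  have "(LINT h : - norm_ball N g \<epsilon> | haar E. (u g - u h) / N (- h + g) powr (Q + 2 * s)) = (\<integral>h. P h \<partial>haar E)"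
    unfolding set_lebesgue_integral_def ind by (rule integral_haar_left) measurable
  then have "2 * (LINT h : - norm_ball N g \<epsilon> | haar E. (u g - u h) / N (- h + g) powr (Q + 2 * s)) =
      (\<integral>h. P h \<partial>haar E) + (\<integral>h. P (- h) \<partial>haar E)"
    by (simp add: integral_haar_uminus)
  also have "\<dots> = (\<integral>h. P h + P (- h) \<partial>haar E)"
    using intP integrable_haar_uminus[OF intP] by simp
  also have "(\<lambda>h. P h + P (- h)) = (\<lambda>h. indicator {h. \<epsilon> \<le> N h} h * frac_integrand N Q s u g h)"
  proof
    fix h
    have "indicator {h. \<epsilon> \<le> N h} (- h) = (indicator {h. \<epsilon> \<le> N h} h :: real)"
      by (simp add: indicator_def)
    then show "P h + P (- h) = indicator {h. \<epsilon> \<le> N h} h * frac_integrand N Q s u g h"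
      by (simp add: P_def frac_integrand_eq algebra_simps add_divide_distrib diff_divide_distrib)
  qed
  finally show "2 * (LINT h : - norm_ball N g \<epsilon> | haar E. (u g - u h) / N (- h + g) powr (Q + 2 * s)) =
      (\<integral>h. indicator {h. \<epsilon> \<le> N h} h * frac_integrand N Q s u g h \<partial>haar E)" .
qed

text \<open>After symmetrization the truncations are cut-offs of \<open>frac_integrand\<close>,
  which is integrable by the second difference bound and dominates them all; a one-sided limit may
  be tested on sequences.\<close>

lemma truncated_integral_tendsto:
  assumes u: "u \<in> test_functions E"
  shows "((\<lambda>\<epsilon>. 2 * (LINT h : - norm_ball N g \<epsilon> | haar E. (u g - u h) / N (- h + g) powr (Q + 2 * s)))
    \<longlongrightarrow> frac_operator E N Q s u g) (at_right 0)"
proof (rule tendsto_at_right_sequentially[OF zero_less_one])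
  fix \<epsilon> :: "nat \<Rightarrow> real"
  assume \<epsilon>: "\<And>i. 0 < \<epsilon> i" "\<epsilon> \<longlonglongrightarrow> 0"
  note int = integrable_frac_integrand[OF u, of g]
  note [measurable] = test_function_measurable[OF u]
  have "(\<lambda>i. \<integral>h. indicator {h. \<epsilon> i \<le> N h} h * frac_integrand N Q s u g h \<partial>haar E)
      \<longlonglongrightarrow> (\<integral>h. frac_integrand N Q s u g h \<partial>haar E)"
  proof (rule integral_dominated_convergence)
    show "integrable (haar E) (\<lambda>h. \<bar>frac_integrand N Q s u g h\<bar>)" using int by simp
    show "AE h in haar E. (\<lambda>i. indicator {h. \<epsilon> i \<le> N h} h * frac_integrand N Q s u g h) \<longlonglongrightarrow> frac_integrand N Q s u g h"
    proof (intro AE_I2)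
      fix h
      show "(\<lambda>i. indicator {h. \<epsilon> i \<le> N h} h * frac_integrand N Q s u g h) \<longlonglongrightarrow> frac_integrand N Q s u g h"
      \<comment> \<open>At the identity the second difference is 0, so the cut-off integrands are
        all 0 there; elsewhere they equal the full integrand once
        \<open>\<epsilon> i < N h\<close>.\<close>
      proof (cases "h = 0")
        case False
        then have "0 < N h" using N_nonneg[of h] N_eq_0_iff[of h] by linarith
        then have "eventually (\<lambda>i. \<epsilon> i < N h) sequentially"
          using \<epsilon>(2) by (simp add: order_tendsto_iff)
        then have "eventually (\<lambda>i. indicator {h. \<epsilon> i \<le> N h} h * frac_integrand N Q s u g h = frac_integrand N Q s u g h) sequentially"
          by eventually_elim simp
        then show ?thesis by (rule tendsto_eventually)
      qed (simp add: frac_integrand_eq)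
    qed
    show "AE h in haar E. norm (indicator {h. \<epsilon> i \<le> N h} h * frac_integrand N Q s u g h) \<le> \<bar>frac_integrand N Q s u g h\<bar>" for i
      by (intro AE_I2) (auto simp: indicator_def)
  qed (unfold frac_integrand_eq, measurable)
  then show "(\<lambda>i. 2 * (LINT h : - norm_ball N g (\<epsilon> i) | haar E. (u g - u h) / N (- h + g) powr (Q + 2 * s)))
    \<longlonglongrightarrow> frac_operator E N Q s u g"
    using \<epsilon>(1) by (simp only: truncated_integral(2)[OF u] frac_operator_def)
qed

end

theorem theorem1p1:
  fixes E :: "'a::euclidean_space \<Rightarrow> 'g::topological_group_add"
    and \<Delta> :: "real \<Rightarrow> 'a \<Rightarrow> 'a"
    and n :: nat and X :: "nat \<Rightarrow> 'a" and d :: "nat \<Rightarrow> real"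
    and N :: "'g \<Rightarrow> real"
    and Q s :: real
  assumes "homogeneous_group E \<Delta> n X d"
    and "homogeneous_norm E \<Delta> N"
    and "Q = (\<Sum>j = 1..n. d j)"
    and "0 < s" and "s < 1"
  shows
    "(\<forall>u\<in>test_functions E. \<forall>\<phi>\<in>test_functions E.
        integrable (haar E \<Otimes>\<^sub>M haar E) (\<lambda>(g, h). dirichlet_integrand N Q s u \<phi> g h)) \<and>
     (\<forall>u\<in>test_functions E. \<forall>\<phi>\<in>test_functions E.
        dirichlet_form E N Q s u \<phi> = dirichlet_form E N Q s \<phi> u) \<and>
     (\<forall>u\<in>test_functions E. \<forall>v\<in>test_functions E. \<forall>\<phi>\<in>test_functions E. \<forall>a b.
        dirichlet_form E N Q s (\<lambda>g. a * u g + b * v g) \<phi> =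
          a * dirichlet_form E N Q s u \<phi> + b * dirichlet_form E N Q s v \<phi>) \<and>
     (\<forall>u\<in>test_functions E. \<forall>g. integrable (haar E) (frac_integrand N Q s u g)) \<and>
     (\<forall>u\<in>test_functions E. \<forall>\<phi>\<in>test_functions E.
        integrable (haar E) (\<lambda>g. \<phi> g * frac_operator E N Q s u g) \<and>
        dirichlet_form E N Q s u \<phi> = (\<integral>g. \<phi> g * frac_operator E N Q s u g \<partial>haar E)) \<and>
     (\<forall>u\<in>test_functions E. \<forall>g.
        (\<forall>\<epsilon>>0. set_integrable (haar E) (- norm_ball N g \<epsilon>)
                  (\<lambda>h. (u g - u h) / N (- h + g) powr (Q + 2 * s))) \<and>
        ((\<lambda>\<epsilon>. 2 * (LINT h : - norm_ball N g \<epsilon> | haar E.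
                       (u g - u h) / N (- h + g) powr (Q + 2 * s)))
           \<longlongrightarrow> frac_operator E N Q s u g) (at_right 0))"
proof -
  interpret homogeneous_normed E \<Delta> n X d N Q s
    by unfold_locales (use assms in auto)
  show ?thesis
    using integrable_dirichlet_integrand dirichlet_form_sym dirichlet_form_linear
      integrable_frac_integrand dirichlet_form_eq_frac_operator truncated_integral(1)
      truncated_integral_tendsto
    by blast
qed

end
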